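(* For every $\delta>0$ there exists a positive Radon measure $\mu$ on $\mathbb{R}$ satisfying $\mu(I)\le(1+\delta)\mu(J)$ for all adjacent intervals $I,J$ of equal length, and a function $g\in\Lambda_\mu$ such that $g$ has infinite $\Phi_q$-variation on $[a,b]$ for every $0<q<1$ and every $a<b$.
   Context: For a nonatomic positive Radon measure $\mu$ on $\mathbb{R}$, $\Lambda_\mu$ is the class of continuous $g\colon\mathbb{R}\to\mathbb{R}$ for which there is $M>0$ with $|g(x+h)-2g(x)+g(x-h)|\le M\mu([x-h,x+h])$ for all $x\in\mathbb{R}$, $h\ge0$. For $q>0$, $\Phi_q\colon[0,\infty)\to[0,\infty)$ is any convex increasing function with $\Phi_q(t)=t/(\log(1/t))^q$ for small $t>0$. A function $v$ has infinite $\Phi$-variation on $[a,b]$ if $\sup\sum_{j=1}^N\Phi(|v(x_j)-v(x_{j-1})|)=\infty$ over all partitions $a=x_0<\dots<x_N=b$, $N\ge1$. *)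

theory Defs
  imports "HOL-Analysis.Analysis"
begin

definition radon_measure :: "real measure \<Rightarrow> bool" where
  "radon_measure \<mu> \<longleftrightarrow> sets \<mu> = sets borel \<and> (\<forall>K. compact K \<longrightarrow> emeasure \<mu> K < \<infinity>)"

definition nonatomic :: "real measure \<Rightarrow> bool" where
  "nonatomic \<mu> \<longleftrightarrow> (\<forall>x. emeasure \<mu> {x} = 0)"

definition Lambda_mu :: "real measure \<Rightarrow> (real \<Rightarrow> real) set" where
  "Lambda_mu \<mu> = {g. continuous_on UNIV g \<and>
     (\<exists>M>0. \<forall>x h. h \<ge> 0 \<longrightarrow>
        \<bar>g (x + h) - 2 * g x + g (x - h)\<bar> \<le> M * measure \<mu> {x - h..x + h})}"

definition is_Phi_q :: "real \<Rightarrow> (real \<Rightarrow> real) \<Rightarrow> bool" where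
  "is_Phi_q q \<Phi> \<longleftrightarrow> convex_on {0..} \<Phi> \<and> mono_on {0..} \<Phi> \<and> (\<forall>t\<ge>0. \<Phi> t \<ge> 0) \<and>
     (\<exists>\<epsilon>>0. \<forall>t. 0 < t \<and> t < \<epsilon> \<longrightarrow> \<Phi> t = t / (ln (1 / t)) powr q)"

definition infinite_Phi_variation :: "(real \<Rightarrow> real) \<Rightarrow> (real \<Rightarrow> real) \<Rightarrow> real \<Rightarrow> real \<Rightarrow> bool" where
  "infinite_Phi_variation \<Phi> v a b \<longleftrightarrow>
     (\<forall>B::real. \<exists>N::nat. \<exists>x::nat \<Rightarrow> real. N \<ge> 1 \<and> x 0 = a \<and> x N = b \<and>
        (\<forall>j<N. x j < x (Suc j)) \<and>
        (\<Sum>j = 1..N. \<Phi> \<bar>v (x j) - v (x (j - 1))\<bar>) > B)"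

end

theory Submission
  imports Defs "HOL-Real_Asymp.Real_Asymp"
begin

text \<open>
  Build \<open>\<mu>\<close> and \<open>g\<close> together by a 4-adic cascade: each cell carries the mean density \<open>w\<close> of \<open>\<mu>\<close> and the mean
  slope \<open>u\<close> of \<open>g\<close>, the outer two of its four children inherit \<open>(u, w)\<close>, and on the middle two either
  \<open>w\<close> becomes \<open>w (1 \<plusminus> \<epsilon>)\<close> or \<open>u\<close> becomes \<open>u \<plusminus> t\<close> with \<open>\<bar>t\<bar> \<le> w\<close>. Since nothing changes near cell boundaries,
  neighbouring cells always have densities of ratio at most \<open>(1 + \<epsilon>) / (1 - \<epsilon>)\<close> and slopes differing by at
  most \<open>2 w\<close>; this gives the almost symmetric doubling of \<open>\<mu>\<close> for small \<open>\<epsilon>\<close> and \<open>g \<in> \<Lambda>\<^sub>\<mu>\<close>.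

  The rule is chosen so that, under \<open>\<mu>\<close>, the ratio \<open>u / w\<close> is positively recurrent at \<open>0\<close>: when it is large, \<open>w\<close>
  moves and the drift of \<open>\<bar>u / w\<bar>\<close> is towards \<open>0\<close>. Each visit to \<open>0\<close> adds to the Lebesgue mean of \<open>\<bar>u\<bar>\<close>,
  which therefore grows linearly in the generation \<open>n\<close>, instead of like \<open>sqrt n\<close>. As \<open>log (1 / \<bar>\<Delta>g\<bar>)\<close> is at
  most of order \<open>n\<close>, the \<open>\<Phi>\<^sub>q\<close>-sum over generation \<open>n\<close> is at least of order \<open>n powr (1 - q)\<close>.
\<close>

section \<open>Functions on the 4-adic grid\<close>

lemma floor_power4_Suc: "\<lfloor>4 ^ Suc n * x\<rfloor> div 4 = \<lfloor>4 ^ n * (x::real)\<rfloor>"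
  using floor_divide_real_eq_div[of 4 "4 ^ Suc n * x"] by simp

lemma floor_power4_tendsto: "(\<lambda>n. of_int \<lfloor>4 ^ n * x\<rfloor> / 4 ^ n) \<longlonglongrightarrow> (x::real)"
proof (rule LIMSEQ_I)
  fix r :: real assume "r > 0"
  obtain N where N: "(1/4) ^ N < r" using real_arch_pow_inv[of r "1/4"] \<open>r > 0\<close> by auto
  have "norm (of_int \<lfloor>4 ^ n * x\<rfloor> / 4 ^ n - x) < r" if "n \<ge> N" for n
  proof -
    have "of_int \<lfloor>4 ^ n * x\<rfloor> \<le> 4 ^ n * x" "4 ^ n * x < of_int \<lfloor>4 ^ n * x\<rfloor> + 1" by linarith+
    then have "\<bar>of_int \<lfloor>4 ^ n * x\<rfloor> - 4 ^ n * x\<bar> / 4 ^ n \<le> 1 / 4 ^ n"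
      by (intro divide_right_mono) (linarith, simp)
    moreover have "of_int \<lfloor>4 ^ n * x\<rfloor> / 4 ^ n - x = (of_int \<lfloor>4 ^ n * x\<rfloor> - 4 ^ n * x) / 4 ^ n"
      by (simp add: diff_divide_distrib)
    ultimately have "norm (of_int \<lfloor>4 ^ n * x\<rfloor> / 4 ^ n - x) \<le> (1/4) ^ n"
      by (simp add: power_one_over)
    also have "\<dots> \<le> (1/4) ^ N" using that by (intro power_decreasing) auto
    finally show ?thesis using N by simp
  qed
  then show "\<exists>no. \<forall>n\<ge>no. norm (of_int \<lfloor>4 ^ n * x\<rfloor> / 4 ^ n - x) < r" by blast
qed

text \<open>The values at the left ends of the cells containing \<open>x\<close> form a uniformly
  Cauchy sequence: one refinement crosses at most three cells of the next generation, each costing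
  \<open>C / 2 ^ Suc n\<close>. The limit inherits continuity from this uniform approximation, and
  \<open>refine\<close> fixes its values on the grid.\<close>

lemma quaternary_grid_extension:
  fixes p :: "nat \<Rightarrow> int \<Rightarrow> real"
  assumes refine: "\<And>n i. p (Suc n) (4 * i) = p n i"
    and incr: "\<And>n i. \<bar>p n (i + 1) - p n i\<bar> \<le> C / 2 ^ n"
  obtains F :: "real \<Rightarrow> real" where "continuous_on UNIV F" "\<And>n i. F (of_int i / 4 ^ n) = p n i"
proof -
  define a where "a n x = p n \<lfloor>4 ^ n * x\<rfloor>" for n and x :: real
  have C: "0 \<le> C" using order_trans[OF abs_ge_zero incr[of 0 0]] by simp
  have p_dist: "\<bar>p n (i + int r) - p n i\<bar> \<le> r * C / 2 ^ n" for n i r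
  proof (induction r)
    case (Suc r)
    then show ?case using incr[of n "i + int r"] by (simp add: algebra_simps add_divide_distrib)
  qed simp
  have step: "\<bar>a (Suc n) x - a n x\<bar> \<le> 3 * C / 2 ^ Suc n" for n x
  proof -
    define j where "j = \<lfloor>4 ^ n * x\<rfloor>"
    define r where "r = nat (\<lfloor>4 ^ Suc n * x\<rfloor> mod 4)"
    have "r < 4" unfolding r_def by simp
    have "\<lfloor>4 ^ Suc n * x\<rfloor> = 4 * (\<lfloor>4 ^ Suc n * x\<rfloor> div 4) + \<lfloor>4 ^ Suc n * x\<rfloor> mod 4"
      by simp
    then have "\<lfloor>4 ^ Suc n * x\<rfloor> = 4 * j + int r"
      unfolding floor_power4_Suc j_def r_def by simp
    then have "\<bar>a (Suc n) x - a n x\<bar> \<le> r * C / 2 ^ Suc n"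
      unfolding a_def using p_dist[of "Suc n" "4 * j" r] by (simp add: refine j_def)
    also have "\<dots> \<le> 3 * C / 2 ^ Suc n"
      using \<open>r < 4\<close> C by (intro divide_right_mono mult_right_mono) auto
    finally show ?thesis .
  qed
  \<comment> \<open>The geometric sum in closed form: each step costs exactly the difference of two
    consecutive subtracted terms.\<close>
  have tail: "\<bar>a (n + k) x - a n x\<bar> \<le> 3 * C / 2 ^ n - 3 * C / 2 ^ (n + k)" for n k x
  proof (induction k)
    case (Suc k)
    have "3 * C / 2 ^ (n + k) = 2 * (3 * C / 2 ^ Suc (n + k))" by simp
    then show ?case using Suc step[of "n + k" x] unfolding add_Suc_right by linarith
  qed simp
  have tail': "\<bar>a m x - a n x\<bar> \<le> 3 * C / 2 ^ n" if "n \<le> m" for m n x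
  proof -
    have "0 \<le> 3 * C / 2 ^ m" using C by simp
    with tail[of n "m - n" x] that show ?thesis by simp
  qed
  have null: "(\<lambda>n. D / 2 ^ n) \<longlonglongrightarrow> 0" for D :: real
    by real_asymp
  have "Cauchy (\<lambda>n. a n x)" for x
  proof (rule metric_CauchyI)
    fix r :: real assume "r > 0"
    then obtain N where N: "6 * C / 2 ^ N < r"
      using order_tendstoD(2)[OF null[of "6 * C"], of r] by (auto simp: eventually_sequentially)
    have "dist (a m x) (a n x) < r" if "m \<ge> N" "n \<ge> N" for m n
      using tail'[OF that(1), of x] tail'[OF that(2), of x] N unfolding dist_real_def by linarith
    then show "\<exists>M. \<forall>m\<ge>M. \<forall>n\<ge>M. dist (a m x) (a n x) < r" by blast
  qed
  then have "\<exists>l. (\<lambda>n. a n x) \<longlonglongrightarrow> l" for x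
    using Cauchy_convergent convergentD by blast
  then obtain F where F: "\<And>x. (\<lambda>n. a n x) \<longlonglongrightarrow> F x" by metis
  have F_near: "\<bar>F x - a n x\<bar> \<le> 3 * C / 2 ^ n" for x n
  proof (rule LIMSEQ_le_const2)
    show "(\<lambda>m. \<bar>a m x - a n x\<bar>) \<longlonglongrightarrow> \<bar>F x - a n x\<bar>"
      by (intro tendsto_intros F)
  qed (use tail' in blast)
  have "continuous_on UNIV F"
    unfolding continuous_on_iff
  proof (intro ballI allI impI)
    fix x r :: real assume "r > 0"
    \<comment> \<open>The 7 is 3 + 1 + 3: two approximation errors and one increment between
      neighbouring cells.\<close>
    then obtain n where n: "7 * C / 2 ^ n < r"
      using order_tendstoD(2)[OF null[of "7 * C"], of r] by (auto simp: eventually_sequentially)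
    have "dist (F y) (F x) < r" if "dist y x < 1 / 4 ^ n" for y
    proof -
      have "\<bar>4 ^ n * y - 4 ^ n * x\<bar> < 1"
        using that unfolding dist_real_def right_diff_distrib[symmetric] abs_mult
        by (simp add: pos_less_divide_eq mult.commute)
      then have "\<lfloor>4 ^ n * y\<rfloor> = \<lfloor>4 ^ n * x\<rfloor> \<or> \<lfloor>4 ^ n * y\<rfloor> = \<lfloor>4 ^ n * x\<rfloor> + 1 \<or> \<lfloor>4 ^ n * x\<rfloor> = \<lfloor>4 ^ n * y\<rfloor> + 1"
        by linarith
      moreover have "0 \<le> C / 2 ^ n" using C by simp
      ultimately have "\<bar>a n y - a n x\<bar> \<le> C / 2 ^ n"
        using incr[of n "\<lfloor>4 ^ n * x\<rfloor>"] incr[of n "\<lfloor>4 ^ n * y\<rfloor>"]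
        unfolding a_def by (elim disjE) (simp_all add: abs_minus_commute)
      then show ?thesis using F_near[of x n] F_near[of y n] n unfolding dist_real_def by linarith
    qed
    then show "\<exists>d>0. \<forall>y\<in>UNIV. dist y x < d \<longrightarrow> dist (F y) (F x) < r"
      by (intro exI[of _ "1 / 4 ^ n"]) auto
  qed
  moreover have "F (of_int i / 4 ^ n) = p n i" for n i
  proof -
    have "a (n + k) (of_int i / 4 ^ n) = p n i" for k
    proof -
      have "\<lfloor>4 ^ (n + k) * (of_int i / 4 ^ n :: real)\<rfloor> = \<lfloor>real_of_int (4 ^ k * i)\<rfloor>"
        by (simp add: power_add)
      then have "a (n + k) (of_int i / 4 ^ n) = p (n + k) (4 ^ k * i)"
        unfolding a_def floor_of_int by simp
      also have "\<dots> = p n i"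
      proof (induction k)
        case (Suc k)
        then show ?case using refine[of "n + k" "4 ^ k * i"] by (simp add: mult.assoc)
      qed simp
      finally show ?thesis .
    qed
    then have "(\<lambda>k. a (k + n) (of_int i / 4 ^ n)) \<longlonglongrightarrow> p n i" by (simp add: add.commute)
    from LIMSEQ_unique[OF F LIMSEQ_offset[OF this]] show ?thesis .
  qed
  ultimately show thesis using that by blast
qed

lemma int_quaternary_cases:
  obtains j :: int where "i = 4 * j" | j where "i = 4 * j + 1" | j where "i = 4 * j + 2" | j where "i = 4 * j + 3"
proof -
  have "i = 4 * (i div 4) + i mod 4" "i mod 4 = 0 \<or> i mod 4 = 1 \<or> i mod 4 = 2 \<or> i mod 4 = 3" by presburger+
  then show thesis using that by (metis add.right_neutral)
qed

text \<open>The primitive on the grid, normalised to vanish at 0: its value at the left end of the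
  parent plus the masses of the siblings further left. Generation 0 uses only \<open>m 0 0\<close>
  because \<open>m 0\<close> will be constant.\<close>

primrec quaternary_sum :: "(nat \<Rightarrow> int \<Rightarrow> real) \<Rightarrow> nat \<Rightarrow> int \<Rightarrow> real" where
  "quaternary_sum m 0 i = m 0 0 * of_int i"
| "quaternary_sum m (Suc n) i = quaternary_sum m n (i div 4) +
     (\<Sum>r<nat (i mod 4). m (Suc n) (4 * (i div 4) + int r))"

text \<open>Inside a parent, one step to the right adds one summand. Additivity is needed only for
  the last child, whose right end is the left end of the next parent.\<close>

lemma additive_cell_function_primitive:
  fixes m :: "nat \<Rightarrow> int \<Rightarrow> real"
  assumes const: "\<And>i. m 0 i = c"
    and additive: "\<And>n i. m n i = m (Suc n) (4 * i) + m (Suc n) (4 * i + 1) + m (Suc n) (4 * i + 2) + m (Suc n) (4 * i + 3)"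
    and bound: "\<And>n i. \<bar>m n i\<bar> \<le> C / 2 ^ n"
  obtains F :: "real \<Rightarrow> real" where "continuous_on UNIV F" "\<And>i. F (of_int i) = c * of_int i"
    "\<And>n i. F ((of_int i + 1) / 4 ^ n) - F (of_int i / 4 ^ n) = m n i"
proof -
  let ?p = "quaternary_sum m"
  have incr: "?p n (i + 1) - ?p n i = m n i" for n i
  proof (induction n arbitrary: i)
    case 0
    then show ?case using const by (simp add: algebra_simps)
  next
    case (Suc n)
    show ?case
    proof (cases i rule: int_quaternary_cases)
      case (4 j)
      have "(4 * j + 3 + 1) div 4 = j + 1" "(4 * j + 3 + 1) mod 4 = 0" "(4 * j + 3) div 4 = j" "(4 * j + 3) mod 4 = 3"
        by presburger+
      then show ?thesis using Suc[of j] additive[of n j] 4 by (simp add: eval_nat_numeral add.commute[of 1 j])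
    next
      case (3 j)
      have "(4 * j + 2 + 1) div 4 = j" "(4 * j + 2 + 1) mod 4 = 3" "(4 * j + 2) div 4 = j" "(4 * j + 2) mod 4 = 2"
        by presburger+
      then show ?thesis using 3 by (simp add: eval_nat_numeral)
    next
      case (2 j)
      have "(4 * j + 1 + 1) div 4 = j" "(4 * j + 1 + 1) mod 4 = 2" "(4 * j + 1) div 4 = j" "(4 * j + 1) mod 4 = 1"
        by presburger+
      then show ?thesis using 2 by (simp add: eval_nat_numeral)
    next
      case (1 j)
      have "(4 * j + 1) div 4 = j" "(4 * j + 1) mod 4 = 1" by presburger+
      then show ?thesis using 1 by simp
    qed
  qed
  have "?p (Suc n) (4 * i) = ?p n i" for n i by simp
  moreover have "\<bar>?p n (i + 1) - ?p n i\<bar> \<le> C / 2 ^ n" for n i using incr bound by simp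
  ultimately obtain F :: "real \<Rightarrow> real" where F: "continuous_on UNIV F" "\<And>n i. F (of_int i / 4 ^ n) = ?p n i"
    by (rule quaternary_grid_extension[of ?p C]) auto
  show thesis
  proof (rule that[OF F(1)])
    show "F (of_int i) = c * of_int i" for i using F(2)[of i 0] const by simp
    show "F ((of_int i + 1) / 4 ^ n) - F (of_int i / 4 ^ n) = m n i" for n i
      using F(2)[of "i + 1" n] F(2)[of i n] incr by simp
  qed
qed

section \<open>Scales, cells and sums over descendants\<close>

lemma quaternary_scale:
  fixes h K :: real
  assumes "0 < h"
  obtains n where "K \<le> 4 ^ n * h" "n = 0 \<or> 4 ^ n * h < 4 * K"
proof -
  obtain m where "K / h < 4 ^ m" using real_arch_pow[of 4 "K / h"] by auto
  then have ex: "\<exists>m. K \<le> 4 ^ m * h" using assms by (auto simp: field_simps intro!: exI[of _ m])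
  define n where "n = (LEAST m. K \<le> 4 ^ m * h)"
  have "K \<le> 4 ^ n * h" unfolding n_def by (rule LeastI_ex[OF ex])
  moreover have "n = 0 \<or> 4 ^ n * h < 4 * K"
  proof (cases n)
    case (Suc m)
    then have "\<not> K \<le> 4 ^ m * h" unfolding n_def by (intro not_less_Least) simp
    then show ?thesis using Suc by simp
  qed simp
  ultimately show thesis using that by blast
qed

lemma quaternary_cell:
  "of_int \<lfloor>4 ^ n * x\<rfloor> / 4 ^ n \<le> (x::real)" "x < (of_int \<lfloor>4 ^ n * x\<rfloor> + 1) / 4 ^ n"
proof -
  have "of_int \<lfloor>4 ^ n * x\<rfloor> \<le> 4 ^ n * x" "4 ^ n * x < of_int \<lfloor>4 ^ n * x\<rfloor> + 1" by linarith+
  then show "of_int \<lfloor>4 ^ n * x\<rfloor> / 4 ^ n \<le> x" "x < (of_int \<lfloor>4 ^ n * x\<rfloor> + 1) / 4 ^ n"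
    by (simp_all add: pos_divide_le_eq pos_less_divide_eq mult.commute)
qed

lemma quaternary_tendsto:
  fixes f :: "real \<Rightarrow> real"
  assumes "continuous_on UNIV f"
  shows "(\<lambda>n. f (of_int \<lfloor>4 ^ n * x\<rfloor> / 4 ^ n)) \<longlonglongrightarrow> f x"
  by (rule continuous_on_tendsto_compose[OF assms floor_power4_tendsto]) simp_all

text \<open>The descendants of cell \<open>i\<close> after \<open>k\<close> generations have the
  indices \<open>4 ^ k * i + j\<close>. Grouping the next generation by parents prepares inductions
  over generations.\<close>

lemma sum_quaternary_Suc:
  fixes f :: "int \<Rightarrow> real"
  shows "(\<Sum>j<4 ^ Suc k. f (4 ^ Suc k * i + int j)) =
    (\<Sum>j<4 ^ k. f (4 * (4 ^ k * i + int j)) + f (4 * (4 ^ k * i + int j) + 1)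
      + f (4 * (4 ^ k * i + int j) + 2) + f (4 * (4 ^ k * i + int j) + 3))"
proof -
  have "(\<Sum>j<4 ^ Suc k. f (4 ^ Suc k * i + int j)) =
      (\<Sum>j<4 ^ k. \<Sum>r = j * 4..<j * 4 + 4. f (4 ^ Suc k * i + int r))"
    by (subst sum.nat_group) (simp add: mult.commute)
  also have "\<dots> = (\<Sum>j<4 ^ k. f (4 * (4 ^ k * i + int j)) + f (4 * (4 ^ k * i + int j) + 1)
      + f (4 * (4 ^ k * i + int j) + 2) + f (4 * (4 ^ k * i + int j) + 3))"
  proof (rule sum.cong[OF refl])
    fix j :: nat
    have *: "{j * 4..<j * 4 + 4} = {4 * j, 4 * j + 1, 4 * j + 2, 4 * j + 3}" by auto
    show "(\<Sum>r = j * 4..<j * 4 + 4. f (4 ^ Suc k * i + int r)) =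
        f (4 * (4 ^ k * i + int j)) + f (4 * (4 ^ k * i + int j) + 1)
      + f (4 * (4 ^ k * i + int j) + 2) + f (4 * (4 ^ k * i + int j) + 3)"
      unfolding * by (simp add: algebra_simps)
  qed
  finally show ?thesis .
qed

section \<open>The cascade\<close>

locale cascade =
  fixes \<epsilon> :: real
  assumes eps: "0 < \<epsilon>" "\<epsilon> \<le> 1/2"
begin

text \<open>On a cell of generation \<open>n\<close>, i.e. an interval \<open>[i / 4 ^ n, (i + 1) / 4 ^ n]\<close>, the state \<open>(u, w)\<close> consists of
  the mean slope \<open>u\<close> of \<open>g\<close> and the mean density \<open>w\<close> of \<open>\<mu>\<close>. While \<open>\<bar>u\<bar> \<le> w\<close>, only \<open>u\<close> moves, to \<open>0\<close> or \<open>2 u\<close>,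
  or to \<open>\<plusminus>w\<close> from \<open>0\<close>; while \<open>\<bar>u\<bar> > w\<close>, only \<open>w\<close> moves.\<close>

definition swing :: "real \<Rightarrow> real \<Rightarrow> real" where
  "swing u w = (if u = 0 then w else if \<bar>u\<bar> \<le> w then u else 0)"

definition tilt :: "real \<Rightarrow> real \<Rightarrow> real" where
  "tilt u w = (if \<bar>u\<bar> \<le> w then 0 else \<epsilon>)"

primrec state :: "nat \<Rightarrow> int \<Rightarrow> real \<times> real" where
  "state 0 i = (0, 1)"
| "state (Suc n) i = (case state n (i div 4) of (u, w) \<Rightarrow>
     if i mod 4 = 1 then (u - swing u w, w * (1 + tilt u w))
     else if i mod 4 = 2 then (u + swing u w, w * (1 - tilt u w))
     else (u, w))"

definition U :: "nat \<Rightarrow> int \<Rightarrow> real" where "U n i = fst (state n i)"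
definition W :: "nat \<Rightarrow> int \<Rightarrow> real" where "W n i = snd (state n i)"

abbreviation "swing_at n i \<equiv> swing (U n i) (W n i)"
abbreviation "tilt_at n i \<equiv> tilt (U n i) (W n i)"

lemma UW_0 [simp]: "U 0 i = 0" "W 0 i = 1"
  by (simp_all add: U_def W_def)

lemma UW_Suc [simp]:
  "U (Suc n) (4 * i) = U n i" "W (Suc n) (4 * i) = W n i"
  "U (Suc n) (4 * i + 1) = U n i - swing_at n i" "W (Suc n) (4 * i + 1) = W n i * (1 + tilt_at n i)"
  "U (Suc n) (4 * i + 2) = U n i + swing_at n i" "W (Suc n) (4 * i + 2) = W n i * (1 - tilt_at n i)"
  "U (Suc n) (4 * i + 3) = U n i" "W (Suc n) (4 * i + 3) = W n i"
proof -
  have "(4 * i + 1) div 4 = i" "(4 * i + 1) mod 4 = 1" "(4 * i + 2) div 4 = i" "(4 * i + 2) mod 4 = 2"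
    "(4 * i + 3) div 4 = i" "(4 * i + 3) mod 4 = 3" by presburger+
  then show "U (Suc n) (4 * i) = U n i" "W (Suc n) (4 * i) = W n i"
    "U (Suc n) (4 * i + 1) = U n i - swing_at n i" "W (Suc n) (4 * i + 1) = W n i * (1 + tilt_at n i)"
    "U (Suc n) (4 * i + 2) = U n i + swing_at n i" "W (Suc n) (4 * i + 2) = W n i * (1 - tilt_at n i)"
    "U (Suc n) (4 * i + 3) = U n i" "W (Suc n) (4 * i + 3) = W n i"
    by (simp_all add: U_def W_def split: prod.splits)
qed

section \<open>Bounds on slopes and densities\<close>

lemma tilt_bounds: "0 \<le> tilt u w" "tilt u w \<le> \<epsilon>" "tilt u w \<le> 1/2"
  using eps by (auto simp: tilt_def)

lemma swing_le: "0 < w \<Longrightarrow> \<bar>swing u w\<bar> \<le> w"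
  by (auto simp: swing_def)

lemma swing_or_tilt: "0 < w \<Longrightarrow> swing u w = 0 \<or> tilt u w = 0"
  by (auto simp: swing_def tilt_def)

lemma W_Suc_between:
  assumes "0 < W n (i div 4)"
  shows "W n (i div 4) * (1 - \<epsilon>) \<le> W (Suc n) i" "W (Suc n) i \<le> W n (i div 4) * (1 + \<epsilon>)"
proof -
  let ?w = "W n (i div 4)"
  have "?w * (1 - \<epsilon>) \<le> ?w" "?w \<le> ?w * (1 + \<epsilon>)"
    using assms eps by (simp_all add: algebra_simps)
  moreover have "?w * (1 - \<epsilon>) \<le> ?w * (1 - tilt_at n (i div 4))" "?w * (1 - tilt_at n (i div 4)) \<le> ?w"
      "?w \<le> ?w * (1 + tilt_at n (i div 4))" "?w * (1 + tilt_at n (i div 4)) \<le> ?w * (1 + \<epsilon>)"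
    using assms tilt_bounds by (simp_all add: algebra_simps)
  moreover have "(4 * j + 1) div 4 = j" "(4 * j + 2) div 4 = j" "(4 * j + 3) div 4 = j" for j :: int
    by presburger+
  ultimately show "W n (i div 4) * (1 - \<epsilon>) \<le> W (Suc n) i" "W (Suc n) i \<le> W n (i div 4) * (1 + \<epsilon>)"
    by (cases i rule: int_quaternary_cases; force)+
qed

lemma W_ge: "(1/2) ^ n \<le> W n i"
proof (induction n arbitrary: i)
  case (Suc n)
  have "0 < W n (i div 4)" using Suc[of "i div 4"] by (rule order.strict_trans2[rotated]) simp
  moreover from this have "W n (i div 4) * (1/2) \<le> W n (i div 4) * (1 - \<epsilon>)"
    using eps by (intro mult_left_mono) auto
  ultimately have "W n (i div 4) * (1/2) \<le> W (Suc n) i"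
    using W_Suc_between(1) order_trans by blast
  with Suc[of "i div 4"] show ?case by simp
qed simp

lemma W_pos [simp]: "0 < W n i"
  using W_ge[of n i] by (rule order.strict_trans2[rotated]) simp

lemma W_nonneg [simp]: "0 \<le> W n i"
  by (simp add: less_imp_le)

lemma W_Suc_le: "W (Suc n) i \<le> 2 * W n (i div 4)"
proof -
  have "W n (i div 4) * (1 + \<epsilon>) \<le> W n (i div 4) * 2" using eps by simp
  then show ?thesis using W_Suc_between(2)[of n i] W_pos[of n "i div 4"] by linarith
qed

lemma W_Suc_ge: "W n (i div 4) \<le> 2 * W (Suc n) i"
proof -
  have "W n (i div 4) * (1/2) \<le> W n (i div 4) * (1 - \<epsilon>)" using eps by simp
  then show ?thesis using W_Suc_between(1)[of n i] W_pos[of n "i div 4"] by linarith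
qed

text \<open>A swing costs \<open>w\<close> from slope 0 and at most \<open>\<bar>u\<bar>\<close>
  otherwise, so the sum at most doubles. As cell lengths shrink by 4, masses and increments decay
  like \<open>1 / 2 ^ n\<close>.\<close>

lemma UW_le: "\<bar>U n i\<bar> + W n i \<le> 2 ^ n"
proof (induction n arbitrary: i)
  case (Suc n)
  have *: "\<bar>u - swing u w\<bar> + w * (1 + tilt u w) \<le> 2 * (\<bar>u\<bar> + w)"
      "\<bar>u + swing u w\<bar> + w * (1 - tilt u w) \<le> 2 * (\<bar>u\<bar> + w)" if "0 < w" for u w
  proof -
    have "w * (1 + \<epsilon>) \<le> w * 2" "w * (1 - \<epsilon>) \<le> w * 2"
      using that eps by (intro mult_left_mono; simp)+
    then have "w * (1 + \<epsilon>) \<le> \<bar>u\<bar> + 2 * w" "w * (1 - \<epsilon>) \<le> \<bar>u\<bar> + 2 * w"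
      by linarith+
    with that show "\<bar>u - swing u w\<bar> + w * (1 + tilt u w) \<le> 2 * (\<bar>u\<bar> + w)"
      "\<bar>u + swing u w\<bar> + w * (1 - tilt u w) \<le> 2 * (\<bar>u\<bar> + w)"
      by (auto simp: swing_def tilt_def)
  qed
  have "(4 * j + 1) div 4 = j" "(4 * j + 2) div 4 = j" "(4 * j + 3) div 4 = j" for j :: int
    by presburger+
  then have "\<bar>U (Suc n) i\<bar> + W (Suc n) i \<le> 2 * (\<bar>U n (i div 4)\<bar> + W n (i div 4))"
    by (cases i rule: int_quaternary_cases) (use * less_imp_le[OF W_pos] in simp_all)
  with Suc[of "i div 4"] show ?case by simp
qed simp

text \<open>From a nonzero slope a swing leads to 0 or doubles the slope; from 0 it leads to
  absolute value \<open>w\<close>. A tilt happens only when \<open>\<bar>u\<bar> > w\<close> and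
  multiplies \<open>w\<close> by less than 2.\<close>

lemma U_eq_0_or_ge: "U n i = 0 \<or> W n i \<le> 2 * \<bar>U n i\<bar>"
proof (induction n arbitrary: i)
  case (Suc n)
  have *: "u - swing u w = 0 \<or> w * (1 + tilt u w) \<le> 2 * \<bar>u - swing u w\<bar>"
      "u + swing u w = 0 \<or> w * (1 - tilt u w) \<le> 2 * \<bar>u + swing u w\<bar>"
    if "u = 0 \<or> w \<le> 2 * \<bar>u\<bar>" "0 < w" for u w
  proof -
    have "w * (1 + \<epsilon>) \<le> w * 2" "w * (1 - \<epsilon>) \<le> w * 2" using that eps by (intro mult_left_mono; simp)+
    then have "w * (1 + \<epsilon>) \<le> 2 * \<bar>u\<bar>" "w * (1 - \<epsilon>) \<le> 2 * \<bar>u\<bar>" if "\<not> \<bar>u\<bar> \<le> w"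
      using that by linarith+
    with that show "u - swing u w = 0 \<or> w * (1 + tilt u w) \<le> 2 * \<bar>u - swing u w\<bar>"
      "u + swing u w = 0 \<or> w * (1 - tilt u w) \<le> 2 * \<bar>u + swing u w\<bar>"
      by (auto simp: swing_def tilt_def)
  qed
  show ?case
    by (cases i rule: int_quaternary_cases) (use Suc *[OF Suc W_pos] in auto)
qed simp

text \<open>The density ratio of the two middle children after a tilt, which is the largest one
  among siblings.\<close>

definition \<rho> :: real where "\<rho> = (1 + \<epsilon>) / (1 - \<epsilon>)"

lemma rho_bounds: "1 \<le> \<rho>" "\<rho> \<le> 3"
  using eps by (auto simp: \<rho>_def field_simps)

text \<open>The outer children inherit the state of their parent, so across a boundary between two
  parents the comparison is the one of the parents, and the constants do not accumulate.\<close>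

lemma adjacent:
  "W n (i + 1) \<le> \<rho> * W n i \<and> W n i \<le> \<rho> * W n (i + 1) \<and>
   \<bar>U n (i + 1) - U n i\<bar> \<le> 2 * W n i \<and> \<bar>U n (i + 1) - U n i\<bar> \<le> 2 * W n (i + 1)"
proof (induction n arbitrary: i)
  case 0
  then show ?case using rho_bounds by simp
next
  case (Suc n)
  have *: "w * (1 + tilt u w) \<le> \<rho> * w" "w \<le> \<rho> * (w * (1 + tilt u w))"
    "w * (1 - tilt u w) \<le> \<rho> * (w * (1 + tilt u w))" "w * (1 + tilt u w) \<le> \<rho> * (w * (1 - tilt u w))"
    "w \<le> \<rho> * (w * (1 - tilt u w))" "w * (1 - tilt u w) \<le> \<rho> * w" if "0 < w" for u w
  proof -
    have 1: "1 + \<epsilon> = \<rho> * (1 - \<epsilon>)" using eps by (simp add: \<rho>_def)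
    have 2: "\<rho> * (1 - \<epsilon>) \<le> \<rho> * (1 - tilt u w)" using tilt_bounds[of u w] rho_bounds by (intro mult_left_mono) auto
    have 3: "\<rho> * (1 - \<epsilon>) \<le> \<rho>" using rho_bounds eps by (simp add: algebra_simps)
    have 4: "\<rho> \<le> \<rho> * (1 + tilt u w)" using rho_bounds tilt_bounds by (simp add: algebra_simps)
    have "w * (1 + tilt u w) \<le> w * \<rho>" "w * 1 \<le> w * (\<rho> * (1 + tilt u w))"
    "w * (1 - tilt u w) \<le> w * (\<rho> * (1 + tilt u w))" "w * (1 + tilt u w) \<le> w * (\<rho> * (1 - tilt u w))"
    "w * 1 \<le> w * (\<rho> * (1 - tilt u w))" "w * (1 - tilt u w) \<le> w * \<rho>"
      using that tilt_bounds[of u w] 1 2 3 4 eps by (intro mult_left_mono; linarith)+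
    then show "w * (1 + tilt u w) \<le> \<rho> * w" "w \<le> \<rho> * (w * (1 + tilt u w))"
    "w * (1 - tilt u w) \<le> \<rho> * (w * (1 + tilt u w))" "w * (1 + tilt u w) \<le> \<rho> * (w * (1 - tilt u w))"
    "w \<le> \<rho> * (w * (1 - tilt u w))" "w * (1 - tilt u w) \<le> \<rho> * w" by (simp_all add: mult_ac)
  qed
  \<comment> \<open>Slope and density never move together: where the slopes of the middle children
    differ, by at most \<open>2 * W n j\<close>, their densities are still that of the
    parent.\<close>
  have sw: "swing_at n j = 0 \<or> tilt_at n j = 0 \<and> \<bar>swing_at n j\<bar> \<le> W n j" for j
    using swing_or_tilt swing_le by (metis W_pos)
  show ?case
  proof (cases i rule: int_quaternary_cases)
    case (1 j)
    show ?thesis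
      using *[OF W_pos[of n j], of "U n j"] sw[of j] tilt_bounds[of "U n j" "W n j"]
      unfolding 1 UW_Suc by auto
  next
    case (2 j)
    then have "i + 1 = 4 * j + 2" by simp
    then show ?thesis
      using *[OF W_pos[of n j], of "U n j"] sw[of j] tilt_bounds[of "U n j" "W n j"]
      unfolding \<open>i + 1 = 4 * j + 2\<close> unfolding 2 UW_Suc by auto
  next
    case (3 j)
    then have "i + 1 = 4 * j + 3" by simp
    then show ?thesis
      using *[OF W_pos[of n j], of "U n j"] sw[of j] tilt_bounds[of "U n j" "W n j"]
      unfolding \<open>i + 1 = 4 * j + 3\<close> unfolding 3 UW_Suc by auto
  next
    case (4 j)
    then have "i + 1 = 4 * (j + 1)" by simp
    then show ?thesis using Suc[of j] unfolding \<open>i + 1 = 4 * (j + 1)\<close> unfolding 4 UW_Suc by simp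
  qed
qed

subsection \<open>The distribution function and the function \<open>g\<close>\<close>

definition F :: "real \<Rightarrow> real" where
  "F = (SOME F. continuous_on UNIV F \<and> (\<forall>i. F (of_int i) = of_int i) \<and>
     (\<forall>n i. F ((of_int i + 1) / 4 ^ n) - F (of_int i / 4 ^ n) = W n i / 4 ^ n))"

definition g :: "real \<Rightarrow> real" where
  "g = (SOME g. continuous_on UNIV g \<and> (\<forall>i. g (of_int i) = 0) \<and>
     (\<forall>n i. g ((of_int i + 1) / 4 ^ n) - g (of_int i / 4 ^ n) = U n i / 4 ^ n))"

lemma four_pow: "(4::real) ^ n = 2 ^ n * 2 ^ n"
  by (simp flip: power_mult_distrib)

text \<open>The opposite tilts of the two middle children cancel, so cell masses are additive and
  the primitive asked for in the definition exists.\<close>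

lemma F_props:
  shows F_cont: "continuous_on UNIV F" and F_int: "F (of_int i) = of_int i"
    and F_cell: "F ((of_int i + 1) / 4 ^ n) - F (of_int i / 4 ^ n) = W n i / 4 ^ n"
proof -
  let ?m = "\<lambda>n i. W n i / 4 ^ n"
  have const: "?m 0 i = 1" for i by simp
  have additive: "?m n i = ?m (Suc n) (4 * i) + ?m (Suc n) (4 * i + 1) + ?m (Suc n) (4 * i + 2)
      + ?m (Suc n) (4 * i + 3)" for n i
    unfolding UW_Suc add_divide_distrib[symmetric] by (simp add: algebra_simps)
  have bound: "\<bar>?m n i\<bar> \<le> 1 / 2 ^ n" for n i
  proof -
    have "\<bar>W n i\<bar> \<le> 2 ^ n" using UW_le[of n i] W_pos[of n i] by linarith
    then show ?thesis by (simp add: four_pow field_simps)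
  qed
  obtain f :: "real \<Rightarrow> real" where "continuous_on UNIV f" "\<And>i. f (of_int i) = 1 * of_int i"
    "\<And>n i. f ((of_int i + 1) / 4 ^ n) - f (of_int i / 4 ^ n) = ?m n i"
    by (rule additive_cell_function_primitive[of ?m, OF const additive bound], rule that)
  then have "\<exists>F::real \<Rightarrow> real. continuous_on UNIV F \<and> (\<forall>i. F (of_int i) = of_int i) \<and>
     (\<forall>n i. F ((of_int i + 1) / 4 ^ n) - F (of_int i / 4 ^ n) = W n i / 4 ^ n)"
    by (intro exI[of _ f]) simp
  from someI_ex[OF this, folded F_def]
  show "continuous_on UNIV F" "F (of_int i) = of_int i"
    "F ((of_int i + 1) / 4 ^ n) - F (of_int i / 4 ^ n) = W n i / 4 ^ n"
    by blast+
qed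

lemma g_props:
  shows g_cont: "continuous_on UNIV g" and g_int: "g (of_int i) = 0"
    and g_cell: "g ((of_int i + 1) / 4 ^ n) - g (of_int i / 4 ^ n) = U n i / 4 ^ n"
proof -
  let ?m = "\<lambda>n i. U n i / 4 ^ n"
  have const: "?m 0 i = 0" for i by simp
  have additive: "?m n i = ?m (Suc n) (4 * i) + ?m (Suc n) (4 * i + 1) + ?m (Suc n) (4 * i + 2)
      + ?m (Suc n) (4 * i + 3)" for n i
    unfolding UW_Suc add_divide_distrib[symmetric] by (simp add: algebra_simps)
  have bound: "\<bar>?m n i\<bar> \<le> 1 / 2 ^ n" for n i
  proof -
    have "\<bar>U n i\<bar> \<le> 2 ^ n" using UW_le[of n i] W_pos[of n i] by linarith
    then show ?thesis by (simp add: four_pow field_simps)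
  qed
  obtain f :: "real \<Rightarrow> real" where "continuous_on UNIV f" "\<And>i. f (of_int i) = 0 * of_int i"
    "\<And>n i. f ((of_int i + 1) / 4 ^ n) - f (of_int i / 4 ^ n) = ?m n i"
    by (rule additive_cell_function_primitive[of ?m, OF const additive bound], rule that)
  then have "\<exists>g::real \<Rightarrow> real. continuous_on UNIV g \<and> (\<forall>i. g (of_int i) = 0) \<and>
     (\<forall>n i. g ((of_int i + 1) / 4 ^ n) - g (of_int i / 4 ^ n) = U n i / 4 ^ n)"
    by (intro exI[of _ f]) simp
  from someI_ex[OF this, folded g_def]
  show "continuous_on UNIV g" "g (of_int i) = 0"
    "g ((of_int i + 1) / 4 ^ n) - g (of_int i / 4 ^ n) = U n i / 4 ^ n"
    by blast+
qed

subsection \<open>Doubling\<close>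

lemma F_grid_bounds:
  assumes "i \<le> j" "\<And>k. i \<le> k \<Longrightarrow> k < j \<Longrightarrow> A \<le> W n k \<and> W n k \<le> B"
  shows "A * of_int (j - i) \<le> (F (of_int j / 4 ^ n) - F (of_int i / 4 ^ n)) * 4 ^ n \<and>
    (F (of_int j / 4 ^ n) - F (of_int i / 4 ^ n)) * 4 ^ n \<le> B * of_int (j - i)"
  using assms
proof (induction j rule: int_ge_induct)
  case (step j)
  have "(F (of_int (j + 1) / 4 ^ n) - F (of_int j / 4 ^ n)) * 4 ^ n = W n j"
    using F_cell[of j n] by simp
  then show ?case using step.IH step.prems step.hyps
    by (simp add: algebra_simps) (smt (verit, ccfv_SIG) step.IH step.prems)
qed simp

lemma F_mono: "x \<le> y \<Longrightarrow> F x \<le> F y"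
proof (rule LIMSEQ_le)
  show "(\<lambda>n. F (of_int \<lfloor>4 ^ n * x\<rfloor> / 4 ^ n)) \<longlonglongrightarrow> F x" "(\<lambda>n. F (of_int \<lfloor>4 ^ n * y\<rfloor> / 4 ^ n)) \<longlonglongrightarrow> F y"
    by (intro quaternary_tendsto F_cont)+
  have "F (of_int \<lfloor>4 ^ n * x\<rfloor> / 4 ^ n) \<le> F (of_int \<lfloor>4 ^ n * y\<rfloor> / 4 ^ n)" if "x \<le> y" for n
  proof -
    have "\<lfloor>4 ^ n * x\<rfloor> \<le> \<lfloor>4 ^ n * y\<rfloor>" using that by (intro floor_mono) simp
    then have "0 \<le> (F (of_int \<lfloor>4 ^ n * y\<rfloor> / 4 ^ n) - F (of_int \<lfloor>4 ^ n * x\<rfloor> / 4 ^ n)) * 4 ^ n"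
      using F_grid_bounds[of "\<lfloor>4 ^ n * x\<rfloor>" "\<lfloor>4 ^ n * y\<rfloor>" 0 n "2 ^ n"] UW_le
      by (smt (verit) W_pos mult_eq_0_iff)
    then have "F (of_int \<lfloor>4 ^ n * x\<rfloor> / 4 ^ n) * 4 ^ n \<le> F (of_int \<lfloor>4 ^ n * y\<rfloor> / 4 ^ n) * 4 ^ n"
      unfolding left_diff_distrib by linarith
    then show ?thesis by simp
  qed
  then show "\<exists>N. \<forall>n\<ge>N. F (of_int \<lfloor>4 ^ n * x\<rfloor> / 4 ^ n) \<le> F (of_int \<lfloor>4 ^ n * y\<rfloor> / 4 ^ n)" if "x \<le> y"
    using that by blast
qed

text \<open>The interval is covered by at most \<open>4 ^ n * (b - a) + 2\<close> cells. It contains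
  at least \<open>4 ^ n * (b - a) - 2\<close> whole cells; when both ends lie in one cell this
  number is not positive, and monotonicity suffices.\<close>

lemma F_bounds:
  assumes "a \<le> b" "0 \<le> A" "\<And>k. \<lfloor>4 ^ n * a\<rfloor> \<le> k \<Longrightarrow> k \<le> \<lfloor>4 ^ n * b\<rfloor> \<Longrightarrow> A \<le> W n k \<and> W n k \<le> B"
  shows "A * (4 ^ n * (b - a) - 2) \<le> (F b - F a) * 4 ^ n" "(F b - F a) * 4 ^ n \<le> B * (4 ^ n * (b - a) + 2)"
proof -
  define i j where "i = \<lfloor>4 ^ n * a\<rfloor>" "j = \<lfloor>4 ^ n * b\<rfloor>"
  have fl: "of_int i \<le> 4 ^ n * a" "4 ^ n * a < of_int i + 1" "of_int j \<le> 4 ^ n * b" "4 ^ n * b < of_int j + 1"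
    unfolding i_j_def by linarith+
  have "i \<le> j" unfolding i_j_def using assms(1) by (intro floor_mono) simp
  have "0 \<le> B" using assms(2) assms(3)[of i] \<open>i \<le> j\<close> unfolding i_j_def by simp
  have "(F b - F a) * 4 ^ n \<le> (F (of_int (j + 1) / 4 ^ n) - F (of_int i / 4 ^ n)) * 4 ^ n"
    using quaternary_cell[where x = a and n = n] quaternary_cell[where x = b and n = n]
    unfolding i_j_def by (intro mult_right_mono diff_mono F_mono) auto
  also have "\<dots> \<le> B * of_int (j + 1 - i)"
    using F_grid_bounds[of i "j + 1" A n B] assms(3) \<open>i \<le> j\<close> unfolding i_j_def by simp
  also have "\<dots> \<le> B * (4 ^ n * (b - a) + 2)"
    using fl \<open>0 \<le> B\<close> by (intro mult_left_mono) (simp_all add: right_diff_distrib)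
  finally show "(F b - F a) * 4 ^ n \<le> B * (4 ^ n * (b - a) + 2)" .
  show "A * (4 ^ n * (b - a) - 2) \<le> (F b - F a) * 4 ^ n"
  proof (cases "i = j")
    case True
    have "4 ^ n * (b - a) - 2 \<le> 0" using fl True by (simp add: right_diff_distrib)
    then have "A * (4 ^ n * (b - a) - 2) \<le> 0" using assms(2) by (simp add: mult_nonneg_nonpos)
    also have "0 \<le> (F b - F a) * 4 ^ n" using F_mono[OF assms(1)] by simp
    finally show ?thesis .
  next
    case False
    have "A * (4 ^ n * (b - a) - 2) \<le> A * of_int (j - (i + 1))"
      using fl assms(2) by (intro mult_left_mono) (simp_all add: right_diff_distrib)
    also have "\<dots> \<le> (F (of_int j / 4 ^ n) - F (of_int (i + 1) / 4 ^ n)) * 4 ^ n"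
      using F_grid_bounds[of "i + 1" j A n B] assms(3) False \<open>i \<le> j\<close> unfolding i_j_def by simp
    also have "\<dots> \<le> (F b - F a) * 4 ^ n"
      using quaternary_cell[where x = a and n = n] quaternary_cell[where x = b and n = n]
      unfolding i_j_def by (intro mult_right_mono diff_mono F_mono) auto
    finally show ?thesis .
  qed
qed

section \<open>Densities of cells at a bounded distance\<close>

lemma adjacent3: "W n (i + 1) \<le> 3 * W n i" "W n i \<le> 3 * W n (i + 1)"
  using adjacent[of n i] mult_right_mono[OF rho_bounds(2) W_nonneg[of n i]]
    mult_right_mono[OF rho_bounds(2) W_nonneg[of n "i + 1"]] by linarith+

lemma W_chain: "W n (i + int d) \<le> \<rho> ^ d * W n i \<and> W n i \<le> \<rho> ^ d * W n (i + int d)"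
proof (induction d)
  case (Suc d)
  have "W n (i + int d + 1) \<le> \<rho> * (\<rho> ^ d * W n i)"
    using adjacent[of n "i + int d"] Suc rho_bounds mult_left_mono[of "W n (i + int d)" "\<rho> ^ d * W n i" \<rho>] by linarith
  moreover have "W n i \<le> \<rho> ^ d * (\<rho> * W n (i + int d + 1))"
  proof -
    have "\<rho> ^ d * W n (i + int d) \<le> \<rho> ^ d * (\<rho> * W n (i + int d + 1))"
      using adjacent[of n "i + int d"] rho_bounds by (intro mult_left_mono) auto
    with Suc show ?thesis by linarith
  qed
  ultimately show ?case by (simp add: ac_simps)
qed simp

lemma W_near:
  assumes "\<bar>k - i\<bar> \<le> int D"
  shows "W n k \<le> \<rho> ^ D * W n i" "W n i \<le> \<rho> ^ D * W n k"
proof -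
  define d where "d = nat \<bar>k - i\<bar>"
  have "W n k \<le> \<rho> ^ d * W n i \<and> W n i \<le> \<rho> ^ d * W n k"
    using W_chain[of n i d] W_chain[of n k d] unfolding d_def by (cases "i \<le> k") auto
  moreover have "\<rho> ^ d \<le> \<rho> ^ D" using assms rho_bounds unfolding d_def by (intro power_increasing) auto
  then have "\<rho> ^ d * W n i \<le> \<rho> ^ D * W n i" "\<rho> ^ d * W n k \<le> \<rho> ^ D * W n k"
    by (intro mult_right_mono; simp)+
  ultimately show "W n k \<le> \<rho> ^ D * W n i" "W n i \<le> \<rho> ^ D * W n k" by linarith+
qed

text \<open>At a scale where \<open>h\<close> is between \<open>K\<close> and \<open>4 * K\<close>
  cells long, all cells meeting the window have densities within a factor
  \<open>\<rho> ^ (4 * K + 1)\<close> of the one at \<open>x\<close>. This enters once in the upper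
  and once in the lower bound; the incomplete cells at the ends cost the fraction in
  \<open>K\<close>. If \<open>n = 0\<close>, all densities are 1 and no upper bound on
  \<open>h\<close> is needed.\<close>

lemma F_doubling:
  fixes x h :: real and K :: nat
  assumes "0 < h" "2 < K"
  defines "c \<equiv> \<rho> ^ (2 * (4 * K + 1)) * ((real K + 2) / (real K - 2))"
  shows "F x - F (x - h) \<le> c * (F (x + h) - F x)" "F (x + h) - F x \<le> c * (F x - F (x - h))"
proof -
  obtain n where n: "real K \<le> 4 ^ n * h" "n = 0 \<or> 4 ^ n * h < 4 * real K"
    by (rule quaternary_scale[OF assms(1), of "real K"])
  define T where "T = 4 ^ n * h"
  define D where "D = 4 * K + 1"
  define w where "w = W n \<lfloor>4 ^ n * x\<rfloor>"
  have "1 \<le> \<rho> ^ D" using rho_bounds by simp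
  have "0 < w" unfolding w_def by simp
  have near: "w / \<rho> ^ D \<le> W n k \<and> W n k \<le> \<rho> ^ D * w"
    if "\<lfloor>4 ^ n * (x - h)\<rfloor> \<le> k" "k \<le> \<lfloor>4 ^ n * (x + h)\<rfloor>" for k
  proof (cases "n = 0")
    case True
    then show ?thesis using \<open>1 \<le> \<rho> ^ D\<close> unfolding w_def by (simp add: field_simps)
  next
    case False
    have "\<lfloor>4 ^ n * x - T\<rfloor> \<le> k" "k \<le> \<lfloor>4 ^ n * x + T\<rfloor>"
      using that unfolding T_def by (simp_all add: algebra_simps)
    moreover have "T < 4 * real K" using n(2) False unfolding T_def by blast
    ultimately have "\<bar>k - \<lfloor>4 ^ n * x\<rfloor>\<bar> \<le> int D" unfolding D_def by linarith
    from W_near[OF this, of n] show ?thesis using \<open>1 \<le> \<rho> ^ D\<close> unfolding w_def by (simp add: field_simps)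
  qed
  have bd: "w / \<rho> ^ D * (T - 2) \<le> (F b - F a) * 4 ^ n" "(F b - F a) * 4 ^ n \<le> \<rho> ^ D * w * (T + 2)"
    if "x - h \<le> a" "b \<le> x + h" "b = a + h" for a b
  proof -
    have "\<lfloor>4 ^ n * (x - h)\<rfloor> \<le> \<lfloor>4 ^ n * a\<rfloor>" "\<lfloor>4 ^ n * b\<rfloor> \<le> \<lfloor>4 ^ n * (x + h)\<rfloor>"
      using that by (auto intro!: floor_mono)
    then show "w / \<rho> ^ D * (T - 2) \<le> (F b - F a) * 4 ^ n" "(F b - F a) * 4 ^ n \<le> \<rho> ^ D * w * (T + 2)"
      using F_bounds[of a b "w / \<rho> ^ D" n "\<rho> ^ D * w"] that near \<open>0 < w\<close> \<open>1 \<le> \<rho> ^ D\<close> assms(1)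
      unfolding T_def by fastforce+
  qed
  have T: "K \<le> T" "2 < T" using n(1) assms(2) unfolding T_def by linarith+
  have "\<rho> ^ D * w * (T + 2) \<le> c * (w / \<rho> ^ D * (T - 2))"
  proof -
    have "(T + 2) / (T - 2) \<le> (real K + 2) / (real K - 2)" using T assms(2) by (simp add: field_simps)
    then have "T + 2 \<le> (real K + 2) / (real K - 2) * (T - 2)" using T by (simp add: pos_divide_le_eq)
    then have "\<rho> ^ D * w * (T + 2) \<le> \<rho> ^ D * w * ((real K + 2) / (real K - 2) * (T - 2))"
      using \<open>0 < w\<close> \<open>1 \<le> \<rho> ^ D\<close> by (intro mult_left_mono) auto
    also have "\<dots> = c * (w / \<rho> ^ D * (T - 2))"
      using \<open>1 \<le> \<rho> ^ D\<close> unfolding c_def D_def[symmetric] mult_2 power_add by simp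
    finally show ?thesis .
  qed
  moreover have "0 \<le> c" using rho_bounds assms(2) unfolding c_def by simp
  ultimately have *: "F b - F a \<le> c * (F b' - F a')"
    if "x - h \<le> a" "b \<le> x + h" "b = a + h" "x - h \<le> a'" "b' \<le> x + h" "b' = a' + h" for a b a' b'
  proof -
    have "(F b - F a) * 4 ^ n \<le> \<rho> ^ D * w * (T + 2)" using bd(2) that by blast
    also have "\<dots> \<le> c * (w / \<rho> ^ D * (T - 2))" by fact
    also have "\<dots> \<le> c * ((F b' - F a') * 4 ^ n)" using bd(1) that \<open>0 \<le> c\<close> by (intro mult_left_mono) blast+
    finally show ?thesis by (simp add: mult.assoc[symmetric])
  qed
  show "F x - F (x - h) \<le> c * (F (x + h) - F x)" "F (x + h) - F x \<le> c * (F x - F (x - h))"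
    using assms(1) by (intro *; simp)+
qed

subsection \<open>The Zygmund condition\<close>

text \<open>The remainder of the affine approximation changes from one generation to the next only
  if \<open>x\<close> lies in a middle child, and then by at most a quarter of \<omega>. As \<omega>
  at least halves each time, the changes add up to at most half of it, and the remainder itself
  tends to 0.\<close>

lemma g_remainder:
  "\<bar>g x - g (of_int \<lfloor>4 ^ n * x\<rfloor> / 4 ^ n) - U n \<lfloor>4 ^ n * x\<rfloor> * (x - of_int \<lfloor>4 ^ n * x\<rfloor> / 4 ^ n)\<bar>
    \<le> W n \<lfloor>4 ^ n * x\<rfloor> / 4 ^ n / 2"
proof -
  define idx where "idx n = \<lfloor>4 ^ n * x\<rfloor>" for n
  define r where "r n = g x - g (of_int (idx n) / 4 ^ n) - U n (idx n) * (x - of_int (idx n) / 4 ^ n)" for n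
  define \<omega> where "\<omega> n = W n (idx n) / 4 ^ n" for n
  have div: "idx (Suc n) div 4 = idx n" for n unfolding idx_def by (rule floor_power4_Suc)
  have omega: "\<omega> (Suc n) \<le> \<omega> n / 2" for n
  proof -
    have "W (Suc n) (idx (Suc n)) \<le> 2 * W n (idx n)" using W_Suc_le[of n "idx (Suc n)"] unfolding div .
    then show ?thesis unfolding \<omega>_def by (simp add: field_simps)
  qed
  have step: "\<bar>r n\<bar> \<le> \<omega> n / 4 + \<bar>r (Suc n)\<bar>" for n
  proof -
    define i where "i = idx n"
    define l where "l = 1 / (4::real) ^ Suc n"
    define t where "t = swing_at n i"
    define \<theta> where "\<theta> = 4 ^ Suc n * x - of_int (idx (Suc n))"
    have "0 < l" unfolding l_def by simp
    have \<theta>: "0 \<le> \<theta>" "\<theta> < 1" unfolding \<theta>_def idx_def by linarith+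
    have tW: "\<bar>t\<bar> \<le> W n i" unfolding t_def by (rule swing_le) simp
    have g1: "g (of_int (4 * i) / 4 ^ Suc n) = g (of_int i / 4 ^ n)" by simp
    have g2: "g (of_int (4 * i + 1) / 4 ^ Suc n) = g (of_int (4 * i) / 4 ^ Suc n) + l * U n i"
      using g_cell[of "4 * i" "Suc n"] unfolding l_def UW_Suc by simp
    have g3: "g (of_int (4 * i + 2) / 4 ^ Suc n) = g (of_int (4 * i + 1) / 4 ^ Suc n) + l * (U n i - t)"
      using g_cell[of "4 * i + 1" "Suc n"] unfolding l_def UW_Suc t_def by (simp add: add.commute)
    have g4: "g (of_int (4 * i + 3) / 4 ^ Suc n) = g (of_int (4 * i + 2) / 4 ^ Suc n) + l * (U n i + t)"
      using g_cell[of "4 * i + 2" "Suc n"] unfolding l_def UW_Suc t_def by (simp add: add.commute)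
    have x: "x - of_int (idx (Suc n)) / 4 ^ Suc n = l * \<theta>"
      unfolding \<theta>_def l_def by (simp add: field_simps)
    have x': "x - of_int i / 4 ^ n = l * (of_int (idx (Suc n) - 4 * i) + \<theta>)"
      unfolding \<theta>_def l_def by (simp add: field_simps)
    have rS: "r (Suc n) = g x - g (of_int (idx (Suc n)) / 4 ^ Suc n) - U (Suc n) (idx (Suc n)) * (l * \<theta>)"
      unfolding r_def x ..
    have rn: "r n = g x - g (of_int i / 4 ^ n) - U n i * (l * (of_int (idx (Suc n) - 4 * i) + \<theta>))"
      unfolding r_def i_def[symmetric] x' ..
    \<comment> \<open>In the first middle child the deviation from the parent's line builds up at
      rate \<open>t\<close>; in the second it is undone at the same rate.\<close>
    have "r n - r (Suc n) = 0 \<or> r n - r (Suc n) = - (l * (\<theta> * t)) \<or> r n - r (Suc n) = - (l * ((1 - \<theta>) * t))"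
    proof (cases "idx (Suc n)" rule: int_quaternary_cases)
      case (1 j)
      with div[of n] have eq: "idx (Suc n) = 4 * i" by (simp add: i_def)
      show ?thesis
        unfolding rS rn eq UW_Suc t_def[symmetric] g1
        by (rule disjI1) (simp add: algebra_simps)
    next
      case (2 j)
      with div[of n] have eq: "idx (Suc n) = 4 * i + 1" by (simp add: i_def)
      show ?thesis
        unfolding rS rn eq UW_Suc t_def[symmetric] g2 g1
        by (rule disjI2, rule disjI1) (simp add: algebra_simps)
    next
      case (3 j)
      with div[of n] have eq: "idx (Suc n) = 4 * i + 2" by (simp add: i_def)
      show ?thesis
        unfolding rS rn eq UW_Suc t_def[symmetric] g3 g2 g1
        by (rule disjI2, rule disjI2) (simp add: algebra_simps)
    next
      case (4 j)
      with div[of n] have eq: "idx (Suc n) = 4 * i + 3" by (simp add: i_def)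
      show ?thesis
        unfolding rS rn eq UW_Suc t_def[symmetric] g4 g3 g2 g1
        by (rule disjI1) (simp add: algebra_simps)
    qed
    moreover have "\<bar>l * (s * t)\<bar> \<le> l * W n i" if "0 \<le> s" "s \<le> 1" for s
    proof -
      have "\<bar>s * t\<bar> \<le> 1 * W n i" unfolding abs_mult using that tW by (intro mult_mono) auto
      then show ?thesis unfolding abs_mult using \<open>0 < l\<close> by simp
    qed
    ultimately have "\<bar>r n - r (Suc n)\<bar> \<le> l * W n i"
      using \<theta> \<open>0 < l\<close> by (elim disjE) simp_all
    moreover have "l * W n i = \<omega> n / 4" unfolding \<omega>_def l_def i_def by simp
    ultimately show ?thesis by linarith
  qed
  have iterate: "\<bar>r n\<bar> \<le> \<omega> n / 2 + \<bar>r (n + k)\<bar>" for k n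
  proof (induction k arbitrary: n)
    case 0
    show ?case unfolding \<omega>_def by simp
  next
    case (Suc k)
    then show ?case using Suc[of "Suc n"] step[of n] omega[of n] by simp
  qed
  have null: "(\<lambda>m. U m (idx m) * (x - of_int (idx m) / 4 ^ m)) \<longlonglongrightarrow> 0"
  proof (rule Lim_null_comparison)
    show "(\<lambda>m. (1/2::real) ^ m) \<longlonglongrightarrow> 0" by (rule LIMSEQ_realpow_zero) auto
    have "norm (U m (idx m) * (x - of_int (idx m) / 4 ^ m)) \<le> (1/2) ^ m" for m
    proof -
      have "\<bar>U m (idx m)\<bar> \<le> 2 ^ m" using UW_le[of m "idx m"] W_pos[of m "idx m"] by linarith
      moreover have "\<bar>x - of_int (idx m) / 4 ^ m\<bar> \<le> 1 / 4 ^ m"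
        using quaternary_cell[where x = x and n = m] unfolding idx_def by (simp add: add_divide_distrib)
      ultimately have "\<bar>U m (idx m) * (x - of_int (idx m) / 4 ^ m)\<bar> \<le> 2 ^ m * (1 / 4 ^ m)"
        unfolding abs_mult by (intro mult_mono) auto
      then show ?thesis by (simp add: four_pow power_one_over)
    qed
    then show "\<forall>\<^sub>F m in sequentially. norm (U m (idx m) * (x - of_int (idx m) / 4 ^ m)) \<le> (1/2) ^ m"
      by simp
  qed
  have "r \<longlonglongrightarrow> g x - g x - 0"
    unfolding r_def using quaternary_tendsto[OF g_cont, of x] null unfolding idx_def by (intro tendsto_intros)
  then have "(\<lambda>k. \<omega> n / 2 + \<bar>r (k + n)\<bar>) \<longlonglongrightarrow> \<omega> n / 2 + \<bar>0\<bar>"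
    by (intro tendsto_intros LIMSEQ_ignore_initial_segment) simp
  then have "\<bar>r n\<bar> \<le> \<omega> n / 2 + \<bar>0\<bar>"
  proof (rule LIMSEQ_le_const)
    show "\<exists>N. \<forall>k\<ge>N. \<bar>r n\<bar> \<le> \<omega> n / 2 + \<bar>r (k + n)\<bar>"
      using iterate[of n] by (auto simp only: add.commute[of _ n])
  qed
  then show ?thesis unfolding r_def \<omega>_def idx_def by simp
qed

text \<open>The line of the cell of \<open>x\<close> also serves on the adjacent cells: the change
  of slope costs at most 2 and the remainder there at most 3/2, in units of
  \<open>W n i / 4 ^ n\<close>.\<close>

lemma g_linear_approx:
  fixes x y :: real
  assumes "4 ^ n * \<bar>y - x\<bar> \<le> 1"
  defines "i \<equiv> \<lfloor>4 ^ n * x\<rfloor>"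
  shows "\<bar>g y - g (of_int i / 4 ^ n) - U n i * (y - of_int i / 4 ^ n)\<bar> \<le> 4 * W n i / 4 ^ n"
proof -
  define j where "j = \<lfloor>4 ^ n * y\<rfloor>"
  define l where "l = 1 / (4::real) ^ n"
  define s where "s = y - of_int j / 4 ^ n"
  have "0 < l" unfolding l_def by simp
  have s: "0 \<le> s" "s \<le> l"
    using quaternary_cell[where x = y and n = n] unfolding s_def j_def l_def by (simp_all add: add_divide_distrib)
  have rem: "\<bar>g y - g (of_int j / 4 ^ n) - U n j * s\<bar> \<le> W n j * l / 2"
    using g_remainder[of y n] unfolding j_def s_def l_def by simp
  have "\<bar>4 ^ n * y - 4 ^ n * x\<bar> \<le> 1"
    using assms(1) by (simp add: abs_mult flip: right_diff_distrib)
  then consider "j = i" | "j = i + 1" | "i = j + 1" unfolding i_def j_def by linarith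
  then have "\<bar>g y - g (of_int i / 4 ^ n) - U n i * (y - of_int i / 4 ^ n)\<bar> \<le> 4 * (W n i * l)"
  proof cases
    case 1
    have "0 \<le> W n i * l" using \<open>0 < l\<close> by simp
    with rem show ?thesis unfolding s_def 1 by linarith
  next
    case 2
    have "W n j * l \<le> 3 * (W n i * l)"
      using adjacent3[of n i] \<open>0 < l\<close> unfolding 2 by simp
    moreover have "\<bar>(U n j - U n i) * s\<bar> \<le> 2 * W n i * l"
      unfolding abs_mult using adjacent[of n i] s unfolding 2 by (intro mult_mono) auto
    moreover have "g y - g (of_int i / 4 ^ n) - U n i * (y - of_int i / 4 ^ n) =
        (g y - g (of_int j / 4 ^ n) - U n j * s) + (U n j - U n i) * s"
    proof -
      have 1: "g (of_int j / 4 ^ n) = g (of_int i / 4 ^ n) + U n i * l"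
        using g_cell[of i n] unfolding 2 l_def by simp
      have 2: "y - of_int i / 4 ^ n = s + l"
        unfolding s_def 2 l_def by (simp add: add_divide_distrib)
      show ?thesis unfolding 1 2 by (simp add: algebra_simps)
    qed
    moreover have "0 \<le> W n i * l" using \<open>0 < l\<close> by simp
    ultimately show ?thesis using rem by linarith
  next
    case 3
    have "W n j * l \<le> 3 * (W n i * l)"
      using adjacent3[of n j] \<open>0 < l\<close> unfolding 3 by simp
    moreover have "\<bar>(U n j - U n i) * (s - l)\<bar> \<le> 2 * W n i * l"
      \<comment> \<open>The lines of both cells meet at the right end of cell \<open>j\<close>,
        hence \<open>s - l\<close> in place of \<open>s\<close>.\<close>
      unfolding abs_mult using adjacent[of n j] s unfolding 3 by (intro mult_mono) auto
    moreover have "g y - g (of_int i / 4 ^ n) - U n i * (y - of_int i / 4 ^ n) =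
        (g y - g (of_int j / 4 ^ n) - U n j * s) + (U n j - U n i) * (s - l)"
    proof -
      have 1: "g (of_int i / 4 ^ n) = g (of_int j / 4 ^ n) + U n j * l"
        using g_cell[of j n] unfolding 3 l_def by simp
      have 2: "y - of_int i / 4 ^ n = s - l"
        unfolding s_def 3 l_def by (simp add: add_divide_distrib)
      show ?thesis unfolding 1 2 by (simp add: algebra_simps)
    qed
    moreover have "0 \<le> W n i * l" using \<open>0 < l\<close> by simp
    ultimately show ?thesis using rem by linarith
  qed
  then show ?thesis unfolding l_def by simp
qed

text \<open>For \<open>h > 1\<close>, \<open>g\<close> is bounded and the interval contains a unit
  cell of mass 1. For smaller \<open>h\<close>, at the scale
  \<open>1/4 \<le> 4 ^ n * h \<le> 1\<close> the affine part cancels and the errors leave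
  \<open>16 * W n i / 4 ^ n\<close>. Two generations later cells are so short that the right
  neighbour of the cell of \<open>x\<close> lies in the interval; the density loses a factor of at
  most 12 and the length 16, and \<open>16 * 12 * 16 = 3072\<close>.\<close>

lemma g_second_difference:
  assumes "0 \<le> h"
  shows "\<bar>g (x + h) - 2 * g x + g (x - h)\<bar> \<le> 3072 * (F (x + h) - F (x - h))"
proof -
  consider "h = 0" | "1 < h" | "0 < h" "h \<le> 1" using assms by linarith
  then show ?thesis
  proof cases
    case 2
    have g_bd: "\<bar>g y\<bar> \<le> 1/2" for y using g_remainder[of y 0] g_int[of "\<lfloor>y\<rfloor>"] by simp
    have "x - h \<le> of_int \<lfloor>x\<rfloor>" "of_int (\<lfloor>x\<rfloor> + 1) \<le> x + h" using 2 by linarith+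
    then have "F (of_int (\<lfloor>x\<rfloor> + 1)) - F (of_int \<lfloor>x\<rfloor>) \<le> F (x + h) - F (x - h)"
      by (intro diff_mono F_mono)
    then have "1 \<le> F (x + h) - F (x - h)" unfolding F_int by simp
    moreover have "\<bar>g (x + h) - 2 * g x + g (x - h)\<bar> \<le> 2"
      using g_bd[of "x + h"] g_bd[of x] g_bd[of "x - h"] unfolding abs_le_iff by linarith
    moreover have "3072 * 1 \<le> 3072 * (F (x + h) - F (x - h))"
      using \<open>1 \<le> F (x + h) - F (x - h)\<close> by (intro mult_left_mono) auto
    ultimately show ?thesis by linarith
  next
    case 3
    obtain n where n: "1/4 \<le> 4 ^ n * h" "n = 0 \<or> 4 ^ n * h < 4 * (1/4)"
      by (rule quaternary_scale[OF 3(1), of "1/4"])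
    define i where "i = \<lfloor>4 ^ n * x\<rfloor>"
    define k where "k = \<lfloor>4 ^ (n + 2) * x\<rfloor>"
    have "4 ^ n * h \<le> 1" using n(2) 3(2) by auto
    define e where "e y = g y - g (of_int i / 4 ^ n) - U n i * (y - of_int i / 4 ^ n)" for y
    have "\<bar>e y\<bar> \<le> 4 * W n i / 4 ^ n" if "y = x \<or> y = x + h \<or> y = x - h" for y
      unfolding e_def i_def using that 3(1) \<open>4 ^ n * h \<le> 1\<close> by (intro g_linear_approx) auto
    from this[of x] this[of "x + h"] this[of "x - h"]
    have "\<bar>e x\<bar> \<le> 4 * W n i / 4 ^ n" "\<bar>e (x + h)\<bar> \<le> 4 * W n i / 4 ^ n" "\<bar>e (x - h)\<bar> \<le> 4 * W n i / 4 ^ n"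
      by simp_all
    then have "\<bar>e (x + h) - 2 * e x + e (x - h)\<bar> \<le> 16 * W n i / 4 ^ n"
      unfolding abs_le_iff by linarith
    moreover have "g (x + h) - 2 * g x + g (x - h) = e (x + h) - 2 * e x + e (x - h)"
      unfolding e_def by (simp add: algebra_simps)
    ultimately have "\<bar>g (x + h) - 2 * g x + g (x - h)\<bar> \<le> 16 * W n i / 4 ^ n" by simp
    also have "\<dots> \<le> 3072 * (W (n + 2) (k + 1) / 4 ^ (n + 2))"
    proof -
      have "k div 4 div 4 = i" using floor_power4_Suc[of "Suc n" x] floor_power4_Suc[of n x] unfolding k_def i_def by simp
      then have "W n i \<le> 4 * W (n + 2) k"
        using W_Suc_ge[of n "k div 4"] W_Suc_ge[of "Suc n" k] by simp
      also have "\<dots> \<le> 12 * W (n + 2) (k + 1)"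
        using adjacent3[of "n + 2" k] by simp
      finally show ?thesis by (simp add: field_simps)
    qed
    also have "\<dots> \<le> 3072 * (F (x + h) - F (x - h))"
    proof -
      have "x - h \<le> of_int (k + 1) / 4 ^ (n + 2)"
        using quaternary_cell(2)[of x "n + 2"] 3(1) unfolding k_def by simp
      moreover have "of_int (k + 1 + 1) / 4 ^ (n + 2) \<le> x + h"
      proof -
        have "of_int k \<le> 4 ^ (n + 2) * x" unfolding k_def by linarith
        moreover have "4 ^ (n + 2) * h = 16 * (4 ^ n * h)" by simp
        then have "2 \<le> 4 ^ (n + 2) * h" using n(1) by linarith
        ultimately have "of_int (k + 1 + 1) \<le> 4 ^ (n + 2) * (x + h)" unfolding distrib_left of_int_add of_int_1 by linarith
        then show ?thesis by (subst pos_divide_le_eq) (auto simp: mult.commute)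
      qed
      ultimately have "F (of_int (k + 1 + 1) / 4 ^ (n + 2)) - F (of_int (k + 1) / 4 ^ (n + 2)) \<le> F (x + h) - F (x - h)"
        by (intro diff_mono F_mono)
      then show ?thesis using F_cell[of "k + 1" "n + 2"] by simp
    qed
    finally show ?thesis .
  qed simp
qed

subsection \<open>Variation\<close>

text \<open>A growth rate valid in all cases of \<open>energy_children\<close>: 1/10 serves while
  the slope moves, the other term while the density moves. The latter is positive by strict
  concavity of the square root.\<close>

definition drift :: real where "drift = min (1/10) ((2 - sqrt (1 + \<epsilon>) - sqrt (1 - \<epsilon>)) / 4)"

lemma drift_pos: "0 < drift"
proof -
  have "1 + \<epsilon> < (1 + \<epsilon> / 2)\<^sup>2" "1 - \<epsilon> < (1 - \<epsilon> / 2)\<^sup>2"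
    using eps by (auto simp: power2_eq_square algebra_simps)
  then have "sqrt (1 + \<epsilon>) < 1 + \<epsilon> / 2" "sqrt (1 - \<epsilon>) < 1 - \<epsilon> / 2"
    using eps by (auto intro!: real_less_lsqrt)
  then have "0 < 2 - sqrt (1 + \<epsilon>) - sqrt (1 - \<epsilon>)" by linarith
  then have "0 < (2 - sqrt (1 + \<epsilon>) - sqrt (1 - \<epsilon>)) / 4" by (rule divide_pos_pos) simp
  then show ?thesis unfolding drift_def min_less_iff_conj by (intro conjI) simp
qed

text \<open>Where \<open>u = 0\<close>, the mean of \<open>\<bar>u\<bar>\<close> over the children grows by \<open>w / 2\<close>; elsewhere it is preserved, but the
  mean of \<open>sqrt (\<bar>u\<bar> w)\<close> decreases by a multiple of \<open>w\<close>. The combination below thus grows in every case.\<close>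

definition energy :: "real \<Rightarrow> real \<Rightarrow> real" where
  "energy u w = 2 * \<bar>u\<bar> - sqrt (\<bar>u\<bar> * w)"

lemma energy_children:
  assumes "0 < w" "u = 0 \<or> w \<le> 2 * \<bar>u\<bar>"
  shows "4 * (energy u w + drift * w) \<le> energy u w + energy (u - swing u w) (w * (1 + tilt u w))
    + energy (u + swing u w) (w * (1 - tilt u w)) + energy u w"
proof -
  define S where "S = sqrt (\<bar>u\<bar> * w)"
  have "drift \<le> 1/10" unfolding drift_def by linarith
  then have drift_w: "drift * w \<le> 1/10 * w" using assms(1) by (simp only: mult_right_mono less_imp_le)
  consider "u = 0" | "u \<noteq> 0" "\<bar>u\<bar> \<le> w" | "u \<noteq> 0" "w < \<bar>u\<bar>" by linarith
  then show ?thesis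
  proof cases
    case 1
    then show ?thesis using assms(1) drift_w by (simp add: energy_def swing_def tilt_def)
  next
    case 2
    \<comment> \<open>Rational bounds for the square roots: \<open>S \<ge> 7/10 * w\<close> and
      \<open>2 - sqrt 2 \<ge> 29/50\<close>, with product 0.406, just above the 4/10 needed.\<close>
    have "(7/10 * w)\<^sup>2 \<le> \<bar>u\<bar> * w"
    proof -
      have "w * w \<le> 2 * \<bar>u\<bar> * w" using assms 2 by (intro mult_right_mono) auto
      moreover have "0 \<le> w * w" by simp
      moreover have "(7/10 * w)\<^sup>2 = 49/100 * (w * w)" by (simp add: power2_eq_square)
      ultimately show ?thesis by linarith
    qed
    then have S: "7/10 * w \<le> S" unfolding S_def by (rule real_le_rsqrt)
    have "sqrt 2 \<le> 142/100" by (rule real_le_lsqrt) (auto simp: power2_eq_square)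
    then have "29/50 * (7/10 * w) \<le> (2 - sqrt 2) * S"
      using S assms(1) by (intro mult_mono) auto
    with drift_w have "4 * (drift * w) \<le> (2 - sqrt 2) * S" using assms(1) by linarith
    moreover have "energy u w = 2 * \<bar>u\<bar> - S" unfolding energy_def S_def ..
    moreover have "energy (u - swing u w) (w * (1 + tilt u w)) = 0"
      using 2 by (simp add: energy_def swing_def)
    moreover have "energy (u + swing u w) (w * (1 - tilt u w)) = 4 * \<bar>u\<bar> - sqrt 2 * S"
      using 2 unfolding energy_def swing_def tilt_def S_def
      by (simp add: abs_mult mult.assoc flip: real_sqrt_mult)
    ultimately show ?thesis by (simp add: algebra_simps)
  next
    case 3
    \<comment> \<open>Only the square-root terms change here; their loss is proportional to
      \<open>S\<close>, which therefore has to dominate \<open>w\<close>.\<close>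
    have "w \<le> S" unfolding S_def
      using assms(1) 3 by (intro real_le_rsqrt) (simp add: power2_eq_square)
    have "drift \<le> (2 - sqrt (1 + \<epsilon>) - sqrt (1 - \<epsilon>)) / 4" unfolding drift_def by (rule min.cobounded2)
    then have "4 * drift \<le> 2 - sqrt (1 + \<epsilon>) - sqrt (1 - \<epsilon>)" by simp
    then have "4 * drift * w \<le> (2 - sqrt (1 + \<epsilon>) - sqrt (1 - \<epsilon>)) * S"
      using \<open>w \<le> S\<close> assms(1) drift_pos by (intro mult_mono; linarith)
    moreover have "energy u w = 2 * \<bar>u\<bar> - S" unfolding energy_def S_def ..
    moreover have "energy (u - swing u w) (w * (1 + tilt u w)) = 2 * \<bar>u\<bar> - S * sqrt (1 + \<epsilon>)"
      using 3 unfolding energy_def swing_def tilt_def S_def by (simp add: mult.assoc flip: real_sqrt_mult)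
    moreover have "energy (u + swing u w) (w * (1 - tilt u w)) = 2 * \<bar>u\<bar> - S * sqrt (1 - \<epsilon>)"
      using 3 unfolding energy_def swing_def tilt_def S_def by (simp add: mult.assoc flip: real_sqrt_mult)
    ultimately show ?thesis by (simp add: algebra_simps)
  qed
qed

section \<open>Linear growth of the total slope\<close>

lemma sum_W: "(\<Sum>j<4 ^ k. W (n + k) (4 ^ k * i + int j)) = 4 ^ k * W n i"
proof (induction k)
  case (Suc k)
  have "(\<Sum>j<4 ^ Suc k. W (n + Suc k) (4 ^ Suc k * i + int j)) = (\<Sum>j<4 ^ k. 4 * W (n + k) (4 ^ k * i + int j))"
    unfolding sum_quaternary_Suc add_Suc_right UW_Suc by (simp add: algebra_simps)
  also have "\<dots> = 4 ^ Suc k * W n i" unfolding sum_distrib_left[symmetric] Suc by simp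
  finally show ?case .
qed simp

text \<open>Each generation raises the mean energy by at least \<open>drift\<close> times the mean
  density, and \<open>sum_W\<close> keeps the latter constant.\<close>

lemma sum_energy_ge:
  "4 ^ k * (energy (U n i) (W n i) + k * drift * W n i)
    \<le> (\<Sum>j<4 ^ k. energy (U (n + k) (4 ^ k * i + int j)) (W (n + k) (4 ^ k * i + int j)))"
proof (induction k)
  case (Suc k)
  let ?E = "\<lambda>n i. energy (U n i) (W n i)"
  have "4 ^ Suc k * (?E n i + Suc k * drift * W n i) =
      4 * (4 ^ k * (?E n i + k * drift * W n i)) + 4 * drift * (4 ^ k * W n i)"
    by (simp add: algebra_simps)
  also have "\<dots> \<le> 4 * (\<Sum>j<4 ^ k. ?E (n + k) (4 ^ k * i + int j)) + 4 * drift * (\<Sum>j<4 ^ k. W (n + k) (4 ^ k * i + int j))"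
    unfolding sum_W using Suc by simp
  also have "\<dots> = (\<Sum>j<4 ^ k. 4 * (?E (n + k) (4 ^ k * i + int j) + drift * W (n + k) (4 ^ k * i + int j)))"
    by (simp add: sum_distrib_left sum.distrib algebra_simps)
  also have "\<dots> \<le> (\<Sum>j<4 ^ Suc k. ?E (n + Suc k) (4 ^ Suc k * i + int j))"
    unfolding sum_quaternary_Suc[of "?E (n + Suc k)"] unfolding add_Suc_right UW_Suc
    by (intro sum_mono energy_children W_pos U_eq_0_or_ge)
  finally show ?case .
qed simp

lemma sum_abs_U_ge:
  "4 ^ k * (energy (U n i) (W n i) + k * drift * W n i) / 2 \<le> (\<Sum>j<4 ^ k. \<bar>U (n + k) (4 ^ k * i + int j)\<bar>)"
proof -
  have "energy u w \<le> 2 * \<bar>u\<bar>" if "0 < w" for u w using that by (simp add: energy_def)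
  then have "(\<Sum>j<4 ^ k. energy (U (n + k) (4 ^ k * i + int j)) (W (n + k) (4 ^ k * i + int j)))
      \<le> (\<Sum>j<4 ^ k. 2 * \<bar>U (n + k) (4 ^ k * i + int j)\<bar>)"
    by (intro sum_mono) simp
  also have "\<dots> = 2 * (\<Sum>j<4 ^ k. \<bar>U (n + k) (4 ^ k * i + int j)\<bar>)" by (simp add: sum_distrib_left)
  finally show ?thesis using sum_energy_ge[of k n i] by simp
qed

text \<open>A nonzero slope is at least half the density, so the increments of \<open>g\<close> are either zero or
  exponentially bounded below; hence the logarithm in \<open>\<Phi>\<close> is of the order of the generation.\<close>

lemma Phi_increment_ge:
  assumes "0 < q" "\<And>t. 0 \<le> t \<Longrightarrow> 0 \<le> \<Phi> t" "\<And>t. 0 < t \<Longrightarrow> t < e \<Longrightarrow> \<Phi> t = t / ln (1 / t) powr q"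
    and "1 \<le> m" "(1/2) ^ m < e"
  shows "\<bar>U m i\<bar> / 4 ^ m / (4 * real m) powr q \<le> \<Phi> (\<bar>U m i\<bar> / 4 ^ m)"
proof (cases "U m i = 0")
  case False
  define t where "t = \<bar>U m i\<bar> / 4 ^ m"
  have "0 < t" using False unfolding t_def by simp
  have "\<bar>U m i\<bar> < 2 ^ m" using UW_le[of m i] W_pos[of m i] by linarith
  then have "t < (1/2) ^ m" unfolding t_def by (simp add: four_pow power_one_over field_simps)
  moreover have "(1/2::real) ^ m \<le> (1/2) ^ 0" using assms(4) by (intro power_decreasing) auto
  ultimately have "t < e" "t < 1" using assms(5) by auto
  \<comment> \<open>A nonzero increment is at least \<open>1 / (2 * 8 ^ m)\<close>, hence at least
    \<open>1 / 16 ^ m\<close> because \<open>m \<ge> 1\<close>; so the logarithm is at most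
    \<open>4 * m\<close>.\<close>
  have "(1/2) ^ m \<le> 2 * \<bar>U m i\<bar>" using U_eq_0_or_ge[of m i] W_ge[of m i] False by linarith
  then have "1 / 4 ^ m * (1/2) ^ m \<le> 1 / 4 ^ m * (2 * \<bar>U m i\<bar>)" by (intro mult_left_mono) auto
  then have "1 \<le> 2 * t * 8 ^ m"
    unfolding t_def by (simp add: power_one_over field_simps flip: power_mult_distrib)
  also have "\<dots> \<le> 2 ^ m * t * 8 ^ m"
    using \<open>0 < t\<close> assms(4) power_increasing[of 1 m "2::real"] by (intro mult_right_mono) auto
  also have "\<dots> = t * 16 ^ m" by (simp add: mult.assoc mult.commute flip: power_mult_distrib)
  finally have "1 / t \<le> 16 ^ m" using \<open>0 < t\<close> by (simp add: field_simps)
  then have "ln (1 / t) \<le> ln (16 ^ m)" using \<open>0 < t\<close> by (intro ln_mono) auto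
  also have "\<dots> = m * ln (2 ^ 4 :: real)" by (simp add: ln_realpow)
  also have "\<dots> = 4 * real m * ln 2" by (subst ln_realpow) auto
  also have "\<dots> \<le> 4 * real m * 1" using ln_2_less_1 by (intro mult_left_mono) auto
  finally have "ln (1 / t) \<le> 4 * m" by simp
  moreover have "0 < ln (1 / t)" using \<open>0 < t\<close> \<open>t < 1\<close> by simp
  ultimately have "t / (4 * real m) powr q \<le> t / ln (1 / t) powr q"
    using \<open>0 < t\<close> assms(1,4) by (intro divide_left_mono powr_mono2 mult_pos_pos) auto
  then show ?thesis using assms(3)[OF \<open>0 < t\<close> \<open>t < e\<close>] unfolding t_def by simp
qed (use assms(2)[of 0] in simp)

text \<open>The partition consists of the descendants of one fixed cell inside the interval. The sum
  of the slopes grows linearly in \<open>k\<close> while the logarithms cost only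
  \<open>(4 * m) powr q\<close>, and \<open>q < 1\<close>.\<close>

lemma infinite_Phi_variation_g:
  assumes "0 < q" "q < 1" "is_Phi_q q \<Phi>" "a < b"
  shows "infinite_Phi_variation \<Phi> g a b"
  unfolding infinite_Phi_variation_def
proof
  fix B :: real
  obtain e where e: "0 < e" "\<And>t. 0 < t \<Longrightarrow> t < e \<Longrightarrow> \<Phi> t = t / ln (1 / t) powr q"
    using assms(3) unfolding is_Phi_q_def by blast
  have Phi_nonneg: "0 \<le> \<Phi> t" if "0 \<le> t" for t using assms(3) that unfolding is_Phi_q_def by blast
  obtain n where n: "(1/4) ^ n < (b - a) / 2" using real_arch_pow_inv[of "(b - a) / 2" "1/4"] assms(4) by auto
  \<comment> \<open>The first cell starting strictly to the right of \<open>a\<close>; it ends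
    before \<open>b\<close> since the interval is longer than two cells.\<close>
  define i where "i = \<lfloor>4 ^ n * a\<rfloor> + 1"
  have ab: "a < of_int i / 4 ^ n" "(of_int i + 1) / 4 ^ n < b"
  proof -
    have i: "4 ^ n * a < of_int i" "of_int i \<le> 4 ^ n * a + 1" unfolding i_def by linarith+
    have "2 < 4 ^ n * (b - a)" using n by (simp add: power_one_over field_simps)
    then have "of_int i + 1 < 4 ^ n * b" using i unfolding right_diff_distrib by linarith
    then show "a < of_int i / 4 ^ n" "(of_int i + 1) / 4 ^ n < b"
      using i by (simp_all add: pos_less_divide_eq pos_divide_less_eq mult.commute)
  qed
  define c0 c1 where "c0 = energy (U n i) (W n i) / 2 / 4 ^ n" "c1 = drift * W n i / 2 / 4 ^ n"
  have "0 < c1" unfolding c0_c1_def using drift_pos by simp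
  have "filterlim (\<lambda>k. (c0 + c1 * real k) / (4 * (real n + real k)) powr q) at_top sequentially"
    using \<open>0 < c1\<close> assms(1,2) by real_asymp
  then have "\<forall>\<^sub>F k in sequentially. B < (c0 + c1 * real k) / (4 * (real n + real k)) powr q"
    unfolding filterlim_at_top_dense by blast
  moreover have "\<forall>\<^sub>F k in sequentially. (1/2) ^ k < e"
    using LIMSEQ_realpow_zero[of "1/2::real"] e(1) by (intro order_tendstoD) auto
  ultimately have "\<forall>\<^sub>F k in sequentially. B < (c0 + c1 * real k) / (4 * (real n + real k)) powr q \<and> (1/2) ^ k < e \<and> 1 \<le> k"
    using eventually_ge_at_top[of 1] by eventually_elim auto
  then obtain k where k: "B < (c0 + c1 * real k) / (4 * (real n + real k)) powr q" "(1/2) ^ k < e" "1 \<le> k"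
    by (auto simp: eventually_sequentially)
  define m where "m = n + k"
  define y where "y j = of_int (4 ^ k * i + int j) / (4::real) ^ m" for j
  \<comment> \<open>The \<open>4 ^ k + 1\<close> grid points, preceded by \<open>a\<close> and
    followed by \<open>b\<close>; the two outer increments contribute nonnegative terms and are
    dropped in the estimate.\<close>
  define x where "x j = (if j = 0 then a else if j = 4 ^ k + 2 then b else y (j - 1))" for j :: nat
  have "(1/2::real) ^ m \<le> (1/2) ^ k" unfolding m_def by (intro power_decreasing) auto
  then have m: "1 \<le> m" "(1/2) ^ m < e" using k unfolding m_def by linarith+
  have y0: "y 0 = of_int i / 4 ^ n" unfolding y_def m_def by (simp add: power_add)
  have yN: "y (4 ^ k) = (of_int i + 1) / 4 ^ n" unfolding y_def m_def by (simp add: power_add field_simps)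
  have y_mono: "y j < y (Suc j)" for j unfolding y_def by (simp add: divide_strict_right_mono)
  have x_less: "x j < x (Suc j)" if "j < 4 ^ k + 2" for j
  proof -
    have "j = 0 \<or> j = 4 ^ k + 1 \<or> 0 < j \<and> j \<le> 4 ^ k"
      using that by (cases "j = 0"; cases "j = 4 ^ k + 1") auto
    then consider "j = 0" | "j = 4 ^ k + 1" | "0 < j" "j \<le> 4 ^ k" by blast
    then show ?thesis
    proof cases
      case 3
      then show ?thesis using y_mono[of "j - 1"] unfolding x_def by simp
    qed (use ab y0 yN in \<open>auto simp: x_def\<close>)
  qed
  have incr: "g (y (Suc j)) - g (y j) = U m (4 ^ k * i + int j) / 4 ^ m" for j
    using g_cell[of "4 ^ k * i + int j" m] unfolding y_def by (simp add: algebra_simps)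
  have "B < (\<Sum>j<4 ^ k. \<bar>U m (4 ^ k * i + int j)\<bar>) / 4 ^ m / (4 * real m) powr q"
  proof -
    have "c0 + c1 * k = (4 ^ k * (energy (U n i) (W n i) + k * drift * W n i) / 2) / 4 ^ m"
      unfolding c0_c1_def m_def by (simp add: power_add field_simps)
    also have "\<dots> \<le> (\<Sum>j<4 ^ k. \<bar>U m (4 ^ k * i + int j)\<bar>) / 4 ^ m"
      using sum_abs_U_ge[of k n i] unfolding m_def by (intro divide_right_mono) auto
    finally have "(c0 + c1 * k) / (4 * real m) powr q \<le> (\<Sum>j<4 ^ k. \<bar>U m (4 ^ k * i + int j)\<bar>) / 4 ^ m / (4 * real m) powr q"
      by (intro divide_right_mono) auto
    with k(1) show ?thesis unfolding m_def by simp
  qed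
  also have "\<dots> = (\<Sum>j<4 ^ k. \<bar>U m (4 ^ k * i + int j)\<bar> / 4 ^ m / (4 * real m) powr q)"
    by (simp add: sum_divide_distrib)
  also have "\<dots> \<le> (\<Sum>j<4 ^ k. \<Phi> (\<bar>U m (4 ^ k * i + int j)\<bar> / 4 ^ m))"
    using assms(1) Phi_nonneg e(2) m by (intro sum_mono Phi_increment_ge)
  also have "\<dots> = (\<Sum>j<4 ^ k. \<Phi> \<bar>g (y (Suc j)) - g (y j)\<bar>)"
    unfolding incr by simp
  also have "\<dots> = (\<Sum>j = 2..4 ^ k + 1. \<Phi> \<bar>g (x j) - g (x (j - 1))\<bar>)"
  proof (rule sum.reindex_bij_witness[of _ "\<lambda>j. j - 2" "\<lambda>j. j + 2"])
    fix j assume "j \<in> {..<4 ^ k :: nat}"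
    then show "\<Phi> \<bar>g (x (j + 2)) - g (x (j + 2 - 1))\<bar> = \<Phi> \<bar>g (y (Suc j)) - g (y j)\<bar>"
      unfolding x_def by simp
  qed auto
  also have "\<dots> \<le> (\<Sum>j = 1..4 ^ k + 2. \<Phi> \<bar>g (x j) - g (x (j - 1))\<bar>)"
    by (intro sum_mono2) (auto intro: Phi_nonneg)
  finally have "B < (\<Sum>j = 1..4 ^ k + 2. \<Phi> \<bar>g (x j) - g (x (j - 1))\<bar>)" .
  moreover have "x 0 = a" "x (4 ^ k + 2) = b" unfolding x_def by auto
  ultimately show "\<exists>N x. 1 \<le> N \<and> x 0 = a \<and> x N = b \<and> (\<forall>j<N. x j < x (Suc j)) \<and>
      B < (\<Sum>j = 1..N. \<Phi> \<bar>g (x j) - g (x (j - 1))\<bar>)"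
    using x_less by (intro exI[of _ "4 ^ k + 2"] exI[of _ x]) auto
qed

end

section \<open>The measure\<close>

lemma interval_measure_Icc:
  assumes "mono F" "continuous_on UNIV F" "a \<le> b"
  shows "emeasure (interval_measure F) {a..b} = ennreal (F b - F a)"
    "measure (interval_measure F) {a..b} = F b - F a"
proof -
  show *: "emeasure (interval_measure F) {a..b} = ennreal (F b - F a)"
    using assms by (intro emeasure_interval_measure_Icc) (auto dest: monoD)
  show "measure (interval_measure F) {a..b} = F b - F a"
    using monoD[OF assms(1,3)] by (simp add: measure_def *)
qed

lemma radon_nonatomic_interval_measure:
  assumes "mono F" "continuous_on UNIV F"
  shows "radon_measure (interval_measure F)" "nonatomic (interval_measure F)"
proof -
  have "emeasure (interval_measure F) K < \<infinity>" if "compact K" for K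
  proof -
    have "bounded K" using that by (rule compact_imp_bounded)
    then obtain r where r: "0 < r" "\<And>x. x \<in> K \<Longrightarrow> norm x \<le> r"
      unfolding bounded_pos by blast
    then have "K \<subseteq> {- r..r}" by (force simp: abs_le_iff)
    then have "emeasure (interval_measure F) K \<le> emeasure (interval_measure F) {- r..r}"
      by (intro emeasure_mono) auto
    also have "\<dots> < \<infinity>" using interval_measure_Icc(1)[OF assms, of "- r" r] r(1) by simp
    finally show ?thesis .
  qed
  then show "radon_measure (interval_measure F)" unfolding radon_measure_def by simp
  show "nonatomic (interval_measure F)"
    unfolding nonatomic_def using interval_measure_Icc(1)[OF assms order_refl] by simp
qed

section \<open>Choice of the parameters and conclusion\<close>

theorem theorem7p1:
  fixes \<delta> :: real
  assumes "\<delta> > 0"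
  shows "\<exists>\<mu> g. radon_measure \<mu> \<and> nonatomic \<mu> \<and>
     (\<forall>x h. h > 0 \<longrightarrow>
        measure \<mu> {x - h..x} \<le> (1 + \<delta>) * measure \<mu> {x..x + h} \<and>
        measure \<mu> {x..x + h} \<le> (1 + \<delta>) * measure \<mu> {x - h..x}) \<and>
     g \<in> Lambda_mu \<mu> \<and>
     (\<forall>q \<Phi> a b. 0 < q \<and> q < 1 \<and> is_Phi_q q \<Phi> \<and> a < b \<longrightarrow> infinite_Phi_variation \<Phi> g a b)"
proof -
  \<comment> \<open>First \<open>K\<close> brings the contribution of the end cells below
    \<open>1 + \<delta>\<close>. This fixes the exponent \<open>D\<close>, and only then
    \<open>e\<close> is taken so small that the power of the density ratio does not spoil the
    bound.\<close>
  have "((\<lambda>x::real. (x + 2) / (x - 2)) \<longlongrightarrow> 1) at_top" by real_asymp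
  then have "((\<lambda>K. (real K + 2) / (real K - 2)) \<longlonglongrightarrow> 1)"
    by (rule filterlim_compose[OF _ filterlim_real_sequentially])
  then have "\<forall>\<^sub>F K in sequentially. (real K + 2) / (real K - 2) < 1 + \<delta>"
    using assms by (intro order_tendstoD) auto
  then have "\<forall>\<^sub>F K in sequentially. (real K + 2) / (real K - 2) < 1 + \<delta> \<and> 3 \<le> K"
    using eventually_ge_at_top[of 3] by eventually_elim auto
  then obtain K where K: "(real K + 2) / (real K - 2) < 1 + \<delta>" "2 < K"
    by (auto simp: eventually_sequentially)
  define D where "D = 2 * (4 * K + 1)"
  define c where "c e = ((1 + e) / (1 - e)) ^ D * ((real K + 2) / (real K - 2))" for e :: real
  have "(c \<longlongrightarrow> ((1 + 0) / (1 - 0)) ^ D * ((real K + 2) / (real K - 2))) (at_right 0)"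
    unfolding c_def by (intro tendsto_intros) auto
  then have "\<forall>\<^sub>F e in at_right 0. c e < 1 + \<delta>"
    using K(1) by (intro order_tendstoD) auto
  moreover have "\<forall>\<^sub>F e in at_right 0. e \<in> {0<..<1/2 :: real}"
    by (intro eventually_at_right_real) auto
  ultimately have "\<forall>\<^sub>F e in at_right 0. c e < 1 + \<delta> \<and> e \<in> {0<..<1/2}"
    by eventually_elim auto
  then obtain e where e: "c e < 1 + \<delta>" "0 < e" "e < 1/2"
    using eventually_happens'[OF trivial_limit_at_right_real] by fastforce
  interpret cascade e using e by unfold_locales auto
  define \<mu> where "\<mu> = interval_measure F"
  have mono: "mono F" by (rule monoI) (rule F_mono)
  have measure: "measure \<mu> {a..b} = F b - F a" if "a \<le> b" for a b
    unfolding \<mu>_def by (rule interval_measure_Icc[OF mono F_cont that])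
  have doubling: "F x - F (x - h) \<le> (1 + \<delta>) * (F (x + h) - F x)"
    "F (x + h) - F x \<le> (1 + \<delta>) * (F x - F (x - h))" if "0 < h" for x h
  proof -
    have "c e * (F (x + h) - F x) \<le> (1 + \<delta>) * (F (x + h) - F x)"
      "c e * (F x - F (x - h)) \<le> (1 + \<delta>) * (F x - F (x - h))"
      using e(1) that F_mono[of x "x + h"] F_mono[of "x - h" x] by (intro mult_right_mono; simp)+
    then show "F x - F (x - h) \<le> (1 + \<delta>) * (F (x + h) - F x)"
      "F (x + h) - F x \<le> (1 + \<delta>) * (F x - F (x - h))"
      using F_doubling[OF that K(2), of x] unfolding c_def D_def \<rho>_def by linarith+
  qed
  have "g \<in> Lambda_mu \<mu>"
    unfolding Lambda_mu_def mem_Collect_eq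
    using g_cont g_second_difference measure by (intro conjI exI[of _ 3072]) auto
  then show ?thesis
    using radon_nonatomic_interval_measure[OF mono F_cont] doubling measure infinite_Phi_variation_g
    unfolding \<mu>_def[symmetric] by (intro exI[of _ \<mu>] exI[of _ g]) auto
qed

end
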